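(* There exists an $\mathsf{MCP}(2,3)$-space $(X,d,\mathfrak m)$ for which neither $\mathrm{ISO}_{\mathfrak m}(X)$ nor $\mathrm{ISO}(X)$ is a Lie group.
   Context: A metric measure space $(X,d,\mathfrak m)$ is a complete separable metric space $(X,d)$ with a non-negative, nonzero Borel measure $\mathfrak m$ that is finite on every bounded set and fully supported, $\mathrm{supp}(\mathfrak m)=X$. $\mathrm{Geo}(X)$ is the space of maps $\gamma:[0,1]\to X$ with $d(\gamma_r,\gamma_s)=|r-s|\,d(\gamma_0,\gamma_1)$, with uniform convergence; $e_t(\gamma)=\gamma_t$; $l(\gamma)=d(\gamma_0,\gamma_1)$ is the length of $\gamma$. $(X,d,\mathfrak m)$ is an $\mathsf{MCP}(2,3)$-space if for every $x\in X$ and every measurable $A\subset X$ with $0<\mathfrak m(A)<\infty$ and $A\subset B(x,\pi)$ there exists a probability measure $\Pi$ on $\mathrm{Geo}(X)$ such that $(e_0)_\#\Pi=\delta_x$, $(e_1)_\#\Pi=\mathfrak m(A)^{-1}\mathfrak m|_A$ and $$(e_t)_\#\Big(t\,\frac{\sin^2(t\,l(\gamma))}{\sin^2(l(\gamma))}\,\mathfrak m(A)\,d\Pi(\gamma)\Big)\le d\mathfrak m\qquad\text{for all }t\in[0,1].$$ $\mathrm{ISO}(X)$ is the group of (surjective) isometries $X\to X$, and $\mathrm{ISO}_{\mathfrak m}(X)$ is the subgroup of those isometries $f$ with $f_\#\mathfrak m=\mathfrak m$. Both carry the compact-open topology. A topological group $G$ with identity component $G_0$ is called a Lie group if $G/G_0$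 is discrete and $G_0$ is a Lie group in the usual smooth sense. *)

theory Defs
  imports "HOL-Analysis.Analysis" "HOL-Probability.Probability" "HOL-Algebra.Bij" "HOL-Algebra.Coset"
begin

section \<open>Metric measure spaces\<close>

definition borel_sigma :: "'a topology \<Rightarrow> 'a measure"
  where "borel_sigma T = sigma (topspace T) {U. openin T U}"

definition measure_support :: "'a topology \<Rightarrow> 'a measure \<Rightarrow> 'a set"
  where "measure_support T \<mu> =
    {x \<in> topspace T. \<forall>U. openin T U \<and> x \<in> U \<longrightarrow> emeasure \<mu> U > 0}"

text \<open>A metric space is given by a carrier set and a distance on it, independently of any
  topology on the ambient type. A separable metric space has at most the cardinality of the
  continuum, so up to isometry every metric measure space has a carrier in
  \<^typ>\<open>real \<times> real\<close>.\<close>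

definition metric_measure_space :: "'a metric \<Rightarrow> 'a measure \<Rightarrow> bool"
  where "metric_measure_space X \<mu> \<longleftrightarrow>
    mcomplete_of X \<and> separable_space (mtopology_of X) \<and>
    sets \<mu> = sets (borel_sigma (mtopology_of X)) \<and>
    emeasure \<mu> (mspace X) \<noteq> 0 \<and>
    (\<forall>B\<in>sets \<mu>. Metric_space.mbounded (mspace X) (mdist X) B \<longrightarrow> emeasure \<mu> B < \<infinity>) \<and>
    measure_support (mtopology_of X) \<mu> = mspace X"


section \<open>The space of geodesics\<close>

text \<open>Curves on the unit interval are functions on the reals that are extensional on the
  interval, so that each curve has exactly one representative.\<close>

definition Geo :: "'a metric \<Rightarrow> (real \<Rightarrow> 'a) set"
  where "Geo X = {\<gamma> \<in> {0..1} \<rightarrow>\<^sub>E mspace X.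
    \<forall>r\<in>{0..1}. \<forall>s\<in>{0..1}. mdist X (\<gamma> r) (\<gamma> s) = \<bar>r - s\<bar> * mdist X (\<gamma> 0) (\<gamma> 1)}"

definition geo_length :: "'a metric \<Rightarrow> (real \<Rightarrow> 'a) \<Rightarrow> real"
  where "geo_length X \<gamma> = mdist X (\<gamma> 0) (\<gamma> 1)"

text \<open>The uniform distance. The value 0 outside \<open>Geo X\<close> is needed because
  \<^locale>\<open>Metric_space\<close> requires symmetry and nonnegativity on the whole type.\<close>

definition geo_dist :: "'a metric \<Rightarrow> (real \<Rightarrow> 'a) \<Rightarrow> (real \<Rightarrow> 'a) \<Rightarrow> real"
  where "geo_dist X \<gamma> \<eta> =
    (if \<gamma> \<in> Geo X \<and> \<eta> \<in> Geo X then SUP t\<in>{0..1}. mdist X (\<gamma> t) (\<eta> t) else 0)"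

lemma GeoD:
  assumes "\<gamma> \<in> Geo X" "r \<in> {0..1}" "s \<in> {0..1}"
  shows "mdist X (\<gamma> r) (\<gamma> s) = \<bar>r - s\<bar> * mdist X (\<gamma> 0) (\<gamma> 1)"
  using assms unfolding Geo_def by blast

lemma Geo_mem: "\<gamma> \<in> Geo X \<Longrightarrow> t \<in> {0..1} \<Longrightarrow> \<gamma> t \<in> mspace X"
  unfolding Geo_def by blast

lemma geo_dist_bdd:
  assumes "\<gamma> \<in> Geo X" "\<eta> \<in> Geo X"
  shows "bdd_above ((\<lambda>t. mdist X (\<gamma> t) (\<eta> t)) ` {0..1})"
proof -
  interpret Metric_space "mspace X" "mdist X" by simp
  have mem: "\<gamma> t \<in> mspace X" "\<eta> t \<in> mspace X" if "t \<in> {0..1}" for t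
    using assms that Geo_mem by blast+
  have "mdist X (\<gamma> t) (\<eta> t)
      \<le> mdist X (\<gamma> 0) (\<gamma> 1) + mdist X (\<gamma> 0) (\<eta> 0) + mdist X (\<eta> 0) (\<eta> 1)"
    if t: "t \<in> {0..1}" for t
  proof -
    have "mdist X (\<gamma> t) (\<gamma> 0) = \<bar>t - 0\<bar> * mdist X (\<gamma> 0) (\<gamma> 1)"
      using assms(1) t by (intro GeoD) auto
    then have 1: "mdist X (\<gamma> t) (\<gamma> 0) \<le> mdist X (\<gamma> 0) (\<gamma> 1)"
      using t by (simp add: mult_left_le_one_le)
    have "mdist X (\<eta> 0) (\<eta> t) = \<bar>0 - t\<bar> * mdist X (\<eta> 0) (\<eta> 1)"
      using assms(2) t by (intro GeoD) auto
    then have 2: "mdist X (\<eta> 0) (\<eta> t) \<le> mdist X (\<eta> 0) (\<eta> 1)"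
      using t by (simp add: mult_left_le_one_le)
    have "mdist X (\<gamma> t) (\<eta> t) \<le> mdist X (\<gamma> t) (\<gamma> 0) + mdist X (\<gamma> 0) (\<eta> t)"
      using mem[of 0] mem[OF t] by (intro triangle) auto
    moreover have "mdist X (\<gamma> 0) (\<eta> t) \<le> mdist X (\<gamma> 0) (\<eta> 0) + mdist X (\<eta> 0) (\<eta> t)"
      using mem[of 0] mem[OF t] by (intro triangle) auto
    ultimately show ?thesis using 1 2 by linarith
  qed
  then show ?thesis by (rule bdd_aboveI2)
qed

lemma Metric_space_Geo: "Metric_space (Geo X) (geo_dist X)"
proof -
  interpret X: Metric_space "mspace X" "mdist X" by simp
  have mem: "\<gamma> t \<in> mspace X" if "\<gamma> \<in> Geo X" "t \<in> {0..1}" for \<gamma> t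
    using that Geo_mem by blast
  have up: "mdist X (\<gamma> t) (\<eta> t) \<le> geo_dist X \<gamma> \<eta>"
    if "\<gamma> \<in> Geo X" "\<eta> \<in> Geo X" "t \<in> {0..1}" for \<gamma> \<eta> t
    using that cSUP_upper[OF that(3) geo_dist_bdd[OF that(1,2)]] by (simp add: geo_dist_def)
  have least: "geo_dist X \<gamma> \<eta> \<le> c"
    if "\<gamma> \<in> Geo X" "\<eta> \<in> Geo X" "\<And>t. t \<in> {0..1} \<Longrightarrow> mdist X (\<gamma> t) (\<eta> t) \<le> c" for \<gamma> \<eta> c
    using that by (auto simp: geo_dist_def intro!: cSUP_least)
  have nonneg: "0 \<le> geo_dist X \<gamma> \<eta>" for \<gamma> \<eta>
  proof (cases "\<gamma> \<in> Geo X \<and> \<eta> \<in> Geo X")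
    case True
    then show ?thesis using order_trans[OF X.nonneg up[of \<gamma> \<eta> 0]] by (simp del: X.nonneg)
  qed (auto simp: geo_dist_def)
  show ?thesis
  proof
    show "0 \<le> geo_dist X \<gamma> \<eta>" for \<gamma> \<eta> by (rule nonneg)
    show "geo_dist X \<gamma> \<eta> = geo_dist X \<eta> \<gamma>" for \<gamma> \<eta>
      by (simp add: geo_dist_def X.commute conj_commute)
    show "geo_dist X \<gamma> \<eta> = 0 \<longleftrightarrow> \<gamma> = \<eta>" if G: "\<gamma> \<in> Geo X" "\<eta> \<in> Geo X" for \<gamma> \<eta>
    proof
      assume "geo_dist X \<gamma> \<eta> = 0"
      then have "\<gamma> t = \<eta> t" if "t \<in> {0..1}" for t
        using up[OF G that] X.zero[OF mem[OF G(1) that] mem[OF G(2) that]]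
          X.nonneg[of "\<gamma> t" "\<eta> t"] by linarith
      then show "\<gamma> = \<eta>"
        using G unfolding Geo_def by (blast intro: PiE_ext)
    next
      assume "\<gamma> = \<eta>"
      then have "geo_dist X \<gamma> \<eta> \<le> 0"
        using G mem by (intro least) auto
      then show "geo_dist X \<gamma> \<eta> = 0" using nonneg[of \<gamma> \<eta>] by linarith
    qed
    show "geo_dist X \<gamma> \<zeta> \<le> geo_dist X \<gamma> \<eta> + geo_dist X \<eta> \<zeta>"
      if G: "\<gamma> \<in> Geo X" "\<eta> \<in> Geo X" "\<zeta> \<in> Geo X" for \<gamma> \<eta> \<zeta>
    proof (rule least[OF G(1,3)])
      fix t :: real assume t: "t \<in> {0..1}"
      have "mdist X (\<gamma> t) (\<zeta> t) \<le> mdist X (\<gamma> t) (\<eta> t) + mdist X (\<eta> t) (\<zeta> t)"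
        using mem t G by (intro X.triangle) auto
      then show "mdist X (\<gamma> t) (\<zeta> t) \<le> geo_dist X \<gamma> \<eta> + geo_dist X \<eta> \<zeta>"
        using up[OF G(1,2) t] up[OF G(2,3) t] by linarith
    qed
  qed
qed

definition Geo_topology :: "'a metric \<Rightarrow> (real \<Rightarrow> 'a) topology"
  where "Geo_topology X = Metric_space.mtopology (Geo X) (geo_dist X)"


section \<open>The measure contraction property MCP(2,3)\<close>

text \<open>The quotient of sines is extended to \<open>l = 0\<close> by its limit. This choice is
  immaterial unless the space is a single point: otherwise points are null sets and
  constant geodesics do not contribute. Lengths \<open>l \<ge> pi\<close> occur only on null sets,
  because the end points lie in an open ball of radius pi around the starting point.\<close>

definition mcp_coeff :: "real \<Rightarrow> real \<Rightarrow> real"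
  where "mcp_coeff t l = t * (if l = 0 then t\<^sup>2 else (sin (t * l))\<^sup>2 / (sin l)\<^sup>2)"

text \<open>The inequality between measures is meant setwise.\<close>

definition MCP_2_3 :: "'a metric \<Rightarrow> 'a measure \<Rightarrow> bool"
  where "MCP_2_3 X \<mu> \<longleftrightarrow> metric_measure_space X \<mu> \<and>
    (\<forall>x\<in>mspace X. \<forall>A\<in>sets \<mu>.
      0 < emeasure \<mu> A \<and> emeasure \<mu> A < \<infinity> \<and> A \<subseteq> mball_of X x pi \<longrightarrow>
      (\<exists>P. prob_space P \<and> sets P = sets (borel_sigma (Geo_topology X)) \<and>
        distr P \<mu> (\<lambda>\<gamma>. \<gamma> 0) = return \<mu> x \<and>
        distr P \<mu> (\<lambda>\<gamma>. \<gamma> 1) = uniform_measure \<mu> A \<and>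
        (\<forall>t\<in>{0..1}. \<forall>B\<in>sets \<mu>.
          emeasure
            (distr
              (density P (\<lambda>\<gamma>. ennreal (mcp_coeff t (geo_length X \<gamma>)) * emeasure \<mu> A))
              \<mu> (\<lambda>\<gamma>. \<gamma> t)) B
          \<le> emeasure \<mu> B)))"


section \<open>Isometry groups\<close>

definition isometries :: "'a metric \<Rightarrow> ('a \<Rightarrow> 'a) set"
  where "isometries X = {f \<in> Bij (mspace X).
    \<forall>x\<in>mspace X. \<forall>y\<in>mspace X. mdist X (f x) (f y) = mdist X x y}"

lemma isometries_continuous:
  assumes "f \<in> isometries X"
  shows "continuous_map (mtopology_of X) (mtopology_of X) f"
proof -
  have "Lipschitz_continuous_map X X f"
    unfolding Lipschitz_continuous_map_def
    using assms Bij_imp_funcset by (intro conjI exI[of _ 1]) (auto simp: isometries_def)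
  then show ?thesis
    by (intro Lipschitz_continuous_imp_continuous_map)
qed

lemma subgroup_isometries: "subgroup (isometries X) (BijGroup (mspace X))"
proof -
  let ?M = "mspace X"
  interpret group "BijGroup ?M" by (rule group_BijGroup)
  have Bij: "f \<in> Bij ?M" if "f \<in> isometries X" for f
    using that by (simp add: isometries_def)
  have mem: "f x \<in> ?M" if "f \<in> isometries X" "x \<in> ?M" for f x
    using Bij_imp_funcset[OF Bij[OF that(1)]] that(2) by blast
  have dist: "mdist X (f x) (f y) = mdist X x y"
    if "f \<in> isometries X" "x \<in> ?M" "y \<in> ?M" for f x y
    using that by (simp add: isometries_def)
  show ?thesis
  proof (rule subgroupI)
    show "isometries X \<subseteq> carrier (BijGroup ?M)" by (auto simp: Bij BijGroup_def)
    have "(\<lambda>x\<in>?M. x) \<in> isometries X" by (simp add: isometries_def id_Bij)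
    then show "isometries X \<noteq> {}" by blast
  next
    fix f g assume f: "f \<in> isometries X" and g: "g \<in> isometries X"
    have "compose ?M f g \<in> isometries X"
      using compose_Bij[OF Bij[OF f] Bij[OF g]]
      by (simp add: isometries_def compose_eq dist[OF f] dist[OF g] mem[OF g])
    then show "f \<otimes>\<^bsub>BijGroup ?M\<^esub> g \<in> isometries X"
      using Bij[OF f] Bij[OF g] by (simp add: BijGroup_def)
  next
    fix f assume f: "f \<in> isometries X"
    have 1: "f (inv_into ?M f x) = x" if "x \<in> ?M" for x
      using Bij[OF f] that by (auto simp: Bij_def bij_betw_def f_inv_into_f)
    have "mdist X (inv_into ?M f x) (inv_into ?M f y) = mdist X x y"
      if "x \<in> ?M" "y \<in> ?M" for x y
      using dist[OF f Bij_inv_into_mem[OF Bij[OF f] that(1)] Bij_inv_into_mem[OF Bij[OF f] that(2)]]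
      by (simp add: 1 that)
    then show "inv\<^bsub>BijGroup ?M\<^esub> f \<in> isometries X"
      using restrict_inv_into_Bij[OF Bij[OF f]]
      by (simp add: inv_BijGroup[OF Bij[OF f]] isometries_def)
  qed
qed

definition ISO :: "'a metric \<Rightarrow> ('a \<Rightarrow> 'a) monoid"
  where "ISO X = (BijGroup (mspace X))\<lparr>carrier := isometries X\<rparr>"

definition ISO_meas :: "'a metric \<Rightarrow> 'a measure \<Rightarrow> ('a \<Rightarrow> 'a) monoid"
  where "ISO_meas X \<mu> =
    (BijGroup (mspace X))\<lparr>carrier := {f \<in> isometries X. distr \<mu> \<mu> f = \<mu>}\<rparr>"

text \<open>Taking \<open>K\<close> empty shows that the topological space consists of all continuous maps.\<close>

definition compact_open_topology :: "'a topology \<Rightarrow> 'b topology \<Rightarrow> ('a \<Rightarrow> 'b) topology"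
  where "compact_open_topology S T = topology_generated_by
    {{f \<in> extensional (topspace S). continuous_map S T f \<and> f ` K \<subseteq> U} | K U.
      compactin S K \<and> openin T U}"

lemma topspace_compact_open_topology:
  "topspace (compact_open_topology S T) = {f \<in> extensional (topspace S). continuous_map S T f}"
    (is "_ = ?C")
proof -
  have "?C \<in> {{f \<in> extensional (topspace S). continuous_map S T f \<and> f ` K \<subseteq> U} | K U.
      compactin S K \<and> openin T U}"
    by (intro CollectI exI[of _ "{}"]) auto
  then show ?thesis
    unfolding compact_open_topology_def topology_generated_by_topspace by blast
qed

definition ISO_topology :: "'a metric \<Rightarrow> ('a \<Rightarrow> 'a) topology"
  where "ISO_topology X =
    subtopology (compact_open_topology (mtopology_of X) (mtopology_of X)) (carrier (ISO X))"

lemma topspace_ISO_topology: "topspace (ISO_topology X) = carrier (ISO X)"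
proof -
  have "isometries X \<subseteq> topspace (compact_open_topology (mtopology_of X) (mtopology_of X))"
    unfolding topspace_compact_open_topology
    using isometries_continuous by (auto simp: isometries_def Bij_def)
  then show ?thesis
    by (auto simp: ISO_topology_def ISO_def)
qed

definition ISO_meas_topology :: "'a metric \<Rightarrow> 'a measure \<Rightarrow> ('a \<Rightarrow> 'a) topology"
  where "ISO_meas_topology X \<mu> =
    subtopology (compact_open_topology (mtopology_of X) (mtopology_of X)) (carrier (ISO_meas X \<mu>))"


section \<open>Smooth maps between open subsets of Euclidean spaces\<close>

text \<open>The dimension has to be quantified inside the notion of a Lie group, hence the use of
  \<^const>\<open>Euclidean_space\<close>, whose points are the sequences vanishing from index \<open>n\<close> on.\<close>

definition partial_deriv :: "nat \<Rightarrow> ((nat \<Rightarrow> real) \<Rightarrow> real) \<Rightarrow> (nat \<Rightarrow> real) \<Rightarrow> real"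
  where "partial_deriv i f x = deriv (\<lambda>s. f (x(i := s))) (x i)"

primrec C_k_on :: "nat \<Rightarrow> nat \<Rightarrow> (nat \<Rightarrow> real) set \<Rightarrow> ((nat \<Rightarrow> real) \<Rightarrow> real) \<Rightarrow> bool" where
  "C_k_on 0 n W f \<longleftrightarrow> continuous_map (subtopology (Euclidean_space n) W) euclideanreal f"
| "C_k_on (Suc k) n W f \<longleftrightarrow>
    continuous_map (subtopology (Euclidean_space n) W) euclideanreal f \<and>
    (\<forall>i<n. (\<forall>x\<in>W. (\<lambda>s. f (x(i := s))) differentiable at (x i)) \<and>
      C_k_on k n W (partial_deriv i f))"

definition smooth_on ::
    "nat \<Rightarrow> nat \<Rightarrow> (nat \<Rightarrow> real) set \<Rightarrow> ((nat \<Rightarrow> real) \<Rightarrow> (nat \<Rightarrow> real)) \<Rightarrow> bool"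
  where "smooth_on n m W f \<longleftrightarrow>
    openin (Euclidean_space n) W \<and> f ` W \<subseteq> topspace (Euclidean_space m) \<and>
    (\<forall>j<m. \<forall>k. C_k_on k n W (\<lambda>x. f x j))"


section \<open>Lie groups\<close>

definition chart :: "nat \<Rightarrow> 'g topology \<Rightarrow> 'g set \<times> ('g \<Rightarrow> nat \<Rightarrow> real) \<Rightarrow> bool"
  where "chart n T = (\<lambda>(U, \<phi>). openin T U \<and> openin (Euclidean_space n) (\<phi> ` U) \<and>
    homeomorphic_map (subtopology T U) (subtopology (Euclidean_space n) (\<phi> ` U)) \<phi>)"

definition smooth_atlas ::
    "nat \<Rightarrow> 'g topology \<Rightarrow> ('g set \<times> ('g \<Rightarrow> nat \<Rightarrow> real)) set \<Rightarrow> bool"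
  where "smooth_atlas n T \<A> \<longleftrightarrow>
    (\<forall>c\<in>\<A>. chart n T c) \<and> (\<Union>(U, \<phi>)\<in>\<A>. U) = topspace T \<and>
    (\<forall>(U, \<phi>)\<in>\<A>. \<forall>(V, \<psi>)\<in>\<A>. smooth_on n n (\<phi> ` (U \<inter> V)) (\<lambda>x. \<psi> (inv_into U \<phi> x)))"

text \<open>A point \<open>z\<close> of \<open>Euclidean_space (n + n)\<close> stands for the pair
  \<open>(left_half n z, right_half n z)\<close> of points of \<open>Euclidean_space n\<close>.\<close>

definition left_half :: "nat \<Rightarrow> (nat \<Rightarrow> real) \<Rightarrow> (nat \<Rightarrow> real)"
  where "left_half n z = (\<lambda>i. if i < n then z i else 0)"

definition right_half :: "nat \<Rightarrow> (nat \<Rightarrow> real) \<Rightarrow> (nat \<Rightarrow> real)"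
  where "right_half n z = (\<lambda>i. if i < n then z (n + i) else 0)"

definition smooth_mult ::
    "nat \<Rightarrow> ('g, 'r) monoid_scheme \<Rightarrow> ('g set \<times> ('g \<Rightarrow> nat \<Rightarrow> real)) set \<Rightarrow> bool"
  where "smooth_mult n G \<A> \<longleftrightarrow>
    (\<forall>(U, \<phi>)\<in>\<A>. \<forall>(V, \<psi>)\<in>\<A>. \<forall>(W, \<theta>)\<in>\<A>.
      let p = (\<lambda>z. inv_into U \<phi> (left_half n z) \<otimes>\<^bsub>G\<^esub> inv_into V \<psi> (right_half n z))
      in smooth_on (n + n) n
        {z \<in> topspace (Euclidean_space (n + n)).
          left_half n z \<in> \<phi> ` U \<and> right_half n z \<in> \<psi> ` V \<and> p z \<in> W}
        (\<lambda>z. \<theta> (p z)))"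

definition smooth_inverse ::
    "nat \<Rightarrow> ('g, 'r) monoid_scheme \<Rightarrow> ('g set \<times> ('g \<Rightarrow> nat \<Rightarrow> real)) set \<Rightarrow> bool"
  where "smooth_inverse n G \<A> \<longleftrightarrow>
    (\<forall>(U, \<phi>)\<in>\<A>. \<forall>(V, \<psi>)\<in>\<A>.
      smooth_on n n {x \<in> \<phi> ` U. inv\<^bsub>G\<^esub> (inv_into U \<phi> x) \<in> V}
        (\<lambda>x. \<psi> (inv\<^bsub>G\<^esub> (inv_into U \<phi> x))))"

text \<open>Lie group in the usual smooth sense: the topology \<open>T\<close> is that of a smooth manifold
  for which the group operations are smooth.\<close>

definition smooth_lie_group :: "('g, 'r) monoid_scheme \<Rightarrow> 'g topology \<Rightarrow> bool"
  where "smooth_lie_group G T \<longleftrightarrow>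
    group G \<and> topspace T = carrier G \<and> Hausdorff_space T \<and> second_countable T \<and>
    (\<exists>n \<A>. smooth_atlas n T \<A> \<and> smooth_mult n G \<A> \<and> smooth_inverse n G \<A>)"

text \<open>A possibly non-connected Lie group, for a topological group \<open>G\<close> with topology \<open>T\<close>
  (that \<open>G\<close> is a topological group is not repeated as a condition). The first conjunct says
  that the quotient topology on \<open>G/G\<^sub>0\<close> is the discrete one.\<close>

definition identity_component :: "('g, 'r) monoid_scheme \<Rightarrow> 'g topology \<Rightarrow> 'g set"
  where "identity_component G T = connected_component_of_set T \<one>\<^bsub>G\<^esub>"

definition lie_group :: "('g, 'r) monoid_scheme \<Rightarrow> 'g topology \<Rightarrow> bool"
  where "lie_group G T \<longleftrightarrow>
    (let G0 = identity_component G T in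
      quotient_map T (discrete_topology (rcosets\<^bsub>G\<^esub> G0)) (\<lambda>g. G0 #>\<^bsub>G\<^esub> g) \<and>
      smooth_lie_group (G\<lparr>carrier := G0\<rparr>) (subtopology T G0))"

end

theory Submission
  imports Defs
begin

text \<open>The space is a thin planar strip \<open>{(x, y). 0 \<le> x \<le> 1/2, \<bar>y\<bar> \<le> width x}\<close> with the
  maximum metric, where \<open>width\<close> is one twelfth of the distance to the closed set \<open>cuts\<close>, which
  consists of 0 and the powers \<open>2\<^sup>-\<^sup>1, 2\<^sup>-\<^sup>2, \<dots>\<close>. Over each gap of \<open>cuts\<close> the strip is a flat
  diamond, and consecutive diamonds touch at one point. The measure is the image of Lebesgue
  measure on the rectangle \<open>params\<close> under \<open>(x, s) \<mapsto> (x, s * width x)\<close>, so the part of the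
  strip over an interval has mass proportional to the length of the interval.

  The isometry groups are not Lie groups. Since \<open>width\<close> has slope at most 1/12, the distance
  between points on different sides of a cut is their horizontal distance
  (\<open>box_dist_across_cut\<close>). Hence, for each cut \<open>z\<close>, the map \<open>flip z\<close> that
  reflects everything to the left of \<open>z\<close> in the horizontal axis is an isometry, and it
  preserves the measure. As \<open>z\<close> tends to 0 these reflections converge to
  the identity (\<open>flips_converge\<close>), so the identity is not isolated. On the other hand the two end
  points are the only points at distance 1/2, so an isometry moves \<open>x\<close> to \<open>x\<close> or \<open>1/2 - x\<close>, and if
  it fixes all first coordinates it moves \<open>y\<close> to \<open>y\<close> or \<open>- y\<close>. Therefore the groups are totally
  disconnected, the identity component is trivial, and discreteness of the quotient by it would make
  the identity isolated (\<open>not_lie_group_if_flips\<close>).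

  The measure contraction property holds because the space is at most two-dimensional while the
  dimension parameter is 3. All lengths are at most 1/2, and there the coefficient of MCP(2,3) is
  bounded by \<open>t * (t * (1 + t) / 2)\<close> (\<open>mcp_coeff_le\<close>). Contraction towards a point \<open>p\<close> scales the
  first coordinate by \<open>t\<close>, so it is enough to contract each fibre, in the parameter \<open>s\<close>, by a
  factor of at least \<open>t * (1 + t) / 2\<close>. Far from \<open>p\<close>, compared with the width at \<open>p\<close>, the vertical
  speed of a path linear in \<open>(x, s)\<close> is below its horizontal speed, so the path is a geodesic for
  the maximum metric, and the fibre factor is \<open>t\<close>. Near \<open>p\<close> such paths
  may fail to be geodesics, but there \<open>width\<close> is concave and nearly constant: straight segments stay in
  the strip, are geodesics, and distort the fibres by \<open>t\<close> times a ratio of widths close to 1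
  (\<open>slope_ge\<close>). The choice between the two depends on \<open>x\<close> only, so different fibres never
  overlap after contraction, and Fubini's theorem gives the bound (\<open>contraction_along_rays\<close>).

  Geodesics are indexed by \<open>(x, s)\<close> instead of by their end point, so that all integrals are taken
  with respect to Lebesgue measure on the rectangle.\<close>

section \<open>The strip and its metric\<close>

definition box_dist :: "real \<times> real \<Rightarrow> real \<times> real \<Rightarrow> real"
  where "box_dist p q = max \<bar>fst p - fst q\<bar> \<bar>snd p - snd q\<bar>"

definition box_metric :: "(real \<times> real) metric"
  where "box_metric = metric (UNIV, box_dist)"

lemma Metric_space_box_dist: "Metric_space UNIV box_dist"
  by standard (auto simp: box_dist_def prod_eq_iff)

lemma mdist_box_metric [simp]: "mdist box_metric = box_dist"
  and mspace_box_metric [simp]: "mspace box_metric = UNIV"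
  using Metric_space.mdist_metric[OF Metric_space_box_dist]
    Metric_space.mspace_metric[OF Metric_space_box_dist]
  by (simp_all add: box_metric_def)

lemma box_dist_le_dist: "box_dist p q \<le> dist p q"
  and dist_le_box_dist: "dist p q \<le> 2 * box_dist p q"
proof -
  show "box_dist p q \<le> dist p q"
    using dist_fst_le[of p q] dist_snd_le[of p q] by (simp add: box_dist_def dist_real_def)
  have "dist p q \<le> \<bar>fst p - fst q\<bar> + \<bar>snd p - snd q\<bar>"
    using sqrt_sum_squares_le_sum_abs[of "fst p - fst q" "snd p - snd q"]
    by (simp add: dist_prod_def dist_real_def)
  also have "\<dots> \<le> 2 * box_dist p q"
    unfolding mult_2 by (intro add_mono) (simp_all add: box_dist_def)
  finally show "dist p q \<le> 2 * box_dist p q" .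
qed

text \<open>The maximum metric induces the product topology of the plane, so Borel sets, compactness
  and continuity may be treated with the Euclidean type-class notions.\<close>

lemma mtopology_box_metric: "mtopology_of box_metric = euclidean"
proof (rule topology_eq[THEN iffD2], intro allI)
  fix U :: "(real \<times> real) set"
  interpret Metric_space UNIV box_dist by (rule Metric_space_box_dist)
  have "openin (mtopology_of box_metric) U \<longleftrightarrow> (\<forall>x\<in>U. \<exists>r>0. \<forall>y. box_dist x y < r \<longrightarrow> y \<in> U)"
    by (auto simp: box_metric_def openin_mtopology subset_iff)
  also have "\<dots> \<longleftrightarrow> (\<forall>x\<in>U. \<exists>r>0. \<forall>y. dist y x < r \<longrightarrow> y \<in> U)"
  proof (intro ball_cong refl iffI)
    fix x assume "\<exists>r>0. \<forall>y. box_dist x y < r \<longrightarrow> y \<in> U"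
    then show "\<exists>r>0. \<forall>y. dist y x < r \<longrightarrow> y \<in> U"
      using box_dist_le_dist order.strict_trans1 by (metis dist_commute)
  next
    fix x assume "\<exists>r>0. \<forall>y. dist y x < r \<longrightarrow> y \<in> U"
    then obtain r where "r > 0" and r: "\<And>y. dist y x < r \<Longrightarrow> y \<in> U" by blast
    have "y \<in> U" if "box_dist x y < r / 2" for y
      using r[of y] dist_le_box_dist[of x y] that by (simp add: dist_commute)
    then show "\<exists>r>0. \<forall>y. box_dist x y < r \<longrightarrow> y \<in> U"
      using \<open>r > 0\<close> by (intro exI[of _ "r / 2"]) auto
  qed
  also have "\<dots> \<longleftrightarrow> openin euclidean U" by (simp add: open_dist)
  finally show "openin (mtopology_of box_metric) U = openin euclidean U" .
qed

definition cuts :: "real set"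
  where "cuts = insert 0 (range (\<lambda>n. (1/2) ^ Suc n))"

text \<open>The factor 1/12 makes the strip so thin that vertical distances matter only between points
  that are close compared with the width of the strip there.\<close>

definition width :: "real \<Rightarrow> real"
  where "width x = infdist x cuts / 12"

definition strip :: "(real \<times> real) set"
  where "strip = {p. 0 \<le> fst p \<and> fst p \<le> 1/2 \<and> \<bar>snd p\<bar> \<le> width (fst p)}"

definition strip_metric :: "(real \<times> real) metric"
  where "strip_metric = submetric box_metric strip"

lemma mspace_strip_metric [simp]: "mspace strip_metric = strip"
  and mdist_strip_metric [simp]: "mdist strip_metric = box_dist"
  and mtopology_strip_metric: "mtopology_of strip_metric = top_of_set strip"
  by (simp_all add: strip_metric_def mtopology_of_submetric mtopology_box_metric)

lemma cuts_nonempty: "cuts \<noteq> {}" by (simp add: cuts_def)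

lemma width_nonneg: "0 \<le> width x"
  by (simp add: width_def infdist_nonneg)

lemma width_le_add: "width x \<le> width y + \<bar>x - y\<bar> / 12"
  using infdist_triangle[of x cuts y] by (simp add: width_def dist_real_def)

lemma width_Lipschitz: "\<bar>width x - width y\<bar> \<le> \<bar>x - y\<bar> / 12"
  using width_le_add[of x y] width_le_add[of y x] unfolding abs_le_iff
  by (simp add: abs_minus_commute)

lemma width_le_cut: "z \<in> cuts \<Longrightarrow> width x \<le> \<bar>x - z\<bar> / 12"
  using infdist_le[of z cuts x] by (simp add: width_def dist_real_def)

lemma width_cut: "z \<in> cuts \<Longrightarrow> width z = 0"
  using width_le_cut[of z z] width_nonneg[of z] by simp

lemma continuous_on_width [continuous_intros]:
  "continuous_on S f \<Longrightarrow> continuous_on S (\<lambda>x. width (f x))"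
  unfolding width_def by (intro continuous_intros) simp_all

lemma borel_measurable_width [measurable]: "width \<in> borel_measurable borel"
  by (intro borel_measurable_continuous_onI continuous_intros)

lemma cut_0: "0 \<in> cuts" and cut_half: "1/2 \<in> cuts"
  by (auto simp: cuts_def intro!: image_eqI[of _ _ 0])

definition line :: "real \<Rightarrow> real \<Rightarrow> real \<Rightarrow> real"
  where "line a b t = (1 - t) * a + t * b"

lemma line_diff: "line a b r - line a b s = (r - s) * (b - a)"
  by (simp add: line_def algebra_simps)

lemma line_diff_right: "line a b t - line a c t = t * (b - c)"
  by (simp add: line_def algebra_simps)

lemma line_diff_end: "b - line a b t = (1 - t) * (b - a)"
  by (simp add: line_def algebra_simps)

lemma line_in_interval:
  assumes "t \<in> {0..1}" "a \<in> {u..v}" "b \<in> {u..v}"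
  shows "line a b t \<in> {u..v}"
  using assms convexD_alt[of "{u..v}" a b t] by (simp add: line_def)

lemma abs_line_le: 
  assumes "t \<in> {0..1}" "\<bar>a\<bar> \<le> u" "\<bar>b\<bar> \<le> v"
  shows "\<bar>line a b t\<bar> \<le> line u v t"
proof -
  have "\<bar>line a b t\<bar> \<le> \<bar>(1 - t) * a\<bar> + \<bar>t * b\<bar>"
    unfolding line_def by (rule abs_triangle_ineq)
  also have "\<dots> \<le> (1 - t) * u + t * v"
    using assms by (auto simp: abs_mult intro!: add_mono mult_left_mono)
  finally show ?thesis by (simp add: line_def)
qed

text \<open>The factor 4 balances two demands: a far point needs its horizontal distance to dominate the
  width, and the width has to be almost constant over the near points.\<close>

definition near :: "real \<Rightarrow> real \<Rightarrow> bool"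
  where "near a x \<longleftrightarrow> \<bar>x - a\<bar> < 4 * width a"

text \<open>If \<open>b\<close> is near \<open>a\<close> then no cut separates them, because a cut \<open>z\<close> satisfies
  \<open>12 * width a \<le> \<bar>a - z\<bar>\<close>. On an interval without cuts the width is an infimum of affine
  functions.\<close>

lemma width_concave:
  assumes "near a b" and t: "t \<in> {0..1}"
  shows "line (width a) (width b) t \<le> width (line a b t)"
proof -
  have "line (width a) (width b) t \<le> \<bar>line a b t - z\<bar> / 12" if z: "z \<in> cuts" for z
  proof -
    have *: "width a \<le> \<bar>a - z\<bar> / 12" "width b \<le> \<bar>b - z\<bar> / 12"
      using width_le_cut[OF z] by auto
    \<comment> \<open>This puts \<open>a\<close> and \<open>b\<close> on the same side of \<open>z\<close>.\<close>
    have "\<bar>b - a\<bar> < \<bar>a - z\<bar>"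
      using assms(1) *(1) by (simp add: near_def)
    then have "(a - z \<ge> 0 \<and> b - z \<ge> 0) \<or> (a - z \<le> 0 \<and> b - z \<le> 0)" by linarith
    then have "line \<bar>a - z\<bar> \<bar>b - z\<bar> t = \<bar>line (a - z) (b - z) t\<bar>"
    proof
      assume "a - z \<ge> 0 \<and> b - z \<ge> 0"
      then show ?thesis using t by (simp add: line_def)
    next
      assume "a - z \<le> 0 \<and> b - z \<le> 0"
      moreover from this have "(1 - t) * (a - z) \<le> 0" "t * (b - z) \<le> 0"
        using t by (auto intro: mult_nonneg_nonpos)
      ultimately show ?thesis using t by (simp add: line_def algebra_simps)
    qed
    moreover have "line (a - z) (b - z) t = line a b t - z"
      by (simp add: line_def algebra_simps)
    moreover have "line (width a) (width b) t \<le> line (\<bar>a - z\<bar> / 12) (\<bar>b - z\<bar> / 12) t"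
      unfolding line_def using * t by (intro add_mono mult_left_mono) auto
    moreover have "line (\<bar>a - z\<bar> / 12) (\<bar>b - z\<bar> / 12) t = line \<bar>a - z\<bar> \<bar>b - z\<bar> t / 12"
      by (simp add: line_def add_divide_distrib)
    ultimately show ?thesis by simp
  qed
  then have "12 * line (width a) (width b) t \<le> infdist (line a b t) cuts"
    unfolding infdist_notempty[OF cuts_nonempty]
    by (intro cINF_greatest cuts_nonempty) (fastforce simp: dist_real_def)
  then show ?thesis by (simp add: width_def)
qed

lemma near_width:
  assumes "near a x"
  shows "0 < width a" "2/3 * width a \<le> width x"
  using assms width_le_add[of a x] abs_ge_zero[of "x - a"] unfolding near_def
  by (simp_all add: abs_minus_commute del: abs_ge_zero)

lemma near_line:
  assumes "near a x" "t \<in> {0..1}"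
  shows "near a (line a x t)"
proof -
  have "\<bar>line a x t - a\<bar> = t * \<bar>x - a\<bar>"
    using line_diff[of a x t 0] assms(2) by (simp add: line_def abs_mult)
  also have "\<dots> \<le> \<bar>x - a\<bar>" using assms(2) by (simp add: mult_left_le_one_le)
  finally show ?thesis using assms(1) by (simp add: near_def)
qed

section \<open>A geodesic from each parameter\<close>

definition param :: "real \<times> real \<Rightarrow> real \<times> real"
  where "param q = (fst q, snd q * width (fst q))"

definition params :: "(real \<times> real) set"
  where "params = {0..1/2} \<times> {-1..1}"

text \<open>The geodesic from \<open>p\<close> to \<open>param q\<close>: a straight segment if the end point is near, and a path that
  is linear in the parameters otherwise. If the width at \<open>p\<close> is 0 then the parameter of \<open>p\<close> is taken to be
  \<open>snd p / 0 = 0\<close>.\<close>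

definition ray :: "real \<times> real \<Rightarrow> real \<times> real \<Rightarrow> real \<Rightarrow> real \<times> real"
  where "ray p q = (\<lambda>t\<in>{0..1}.
    (line (fst p) (fst q) t,
     if near (fst p) (fst q) then line (snd p) (snd (param q)) t
     else line (snd p / width (fst p)) (snd q) t * width (line (fst p) (fst q) t)))"

lemma param_in_strip: "q \<in> params \<Longrightarrow> param q \<in> strip"
  using width_nonneg
  by (auto simp: params_def param_def strip_def abs_mult intro!: mult_left_le_one_le)

lemma strip_ratio:
  assumes "p \<in> strip"
  shows "\<bar>snd p / width (fst p)\<bar> \<le> 1"
    and "snd p / width (fst p) * width (fst p) = snd p"
  using assms width_nonneg[of "fst p"]
  by (cases "width (fst p) = 0"; force simp: strip_def divide_simps)+

lemma strip_subset_param: "p \<in> strip \<Longrightarrow> \<exists>q\<in>params. param q = p"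
proof (intro bexI[of _ "(fst p, snd p / width (fst p))"])
  assume p: "p \<in> strip"
  show "param (fst p, snd p / width (fst p)) = p"
    using strip_ratio(2)[OF p] by (simp add: param_def)
  have "\<bar>r\<bar> \<le> 1 \<Longrightarrow> r \<in> {-1..1}" for r :: real by auto
  then show "(fst p, snd p / width (fst p)) \<in> params"
    using strip_ratio(1)[OF p] p by (simp add: params_def strip_def)
qed

lemma ray_0: "p \<in> strip \<Longrightarrow> ray p q 0 = p"
  using strip_ratio(2)[of p] by (simp add: ray_def line_def)

lemma ray_1: "ray p q 1 = param q"
  by (simp add: ray_def line_def param_def)

lemma ray_in_strip:
  assumes p: "p \<in> strip" and q: "q \<in> params" and t: "t \<in> {0..1}"
  shows "ray p q t \<in> strip"
proof -
  let ?x = "line (fst p) (fst q) t"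
  have x: "?x \<in> {0..1/2}"
    using p q t by (intro line_in_interval) (auto simp: strip_def params_def)
  have "\<bar>snd (ray p q t)\<bar> \<le> width ?x"
  proof (cases "near (fst p) (fst q)")
    case True
    have "\<bar>line (snd p) (snd (param q)) t\<bar> \<le> line (width (fst p)) (width (fst q)) t"
      using p param_in_strip[OF q] t by (intro abs_line_le) (auto simp: strip_def param_def)
    also have "\<dots> \<le> width ?x" using True t by (rule width_concave)
    finally show ?thesis using True t by (simp add: ray_def)
  next
    case False
    have "\<bar>line (snd p / width (fst p)) (snd q) t\<bar> \<le> line 1 1 t"
      using strip_ratio(1)[OF p] q t by (intro abs_line_le) (auto simp: params_def abs_le_iff)
    then have "\<bar>line (snd p / width (fst p)) (snd q) t\<bar> * width ?x \<le> width ?x"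
      using width_nonneg by (intro mult_left_le_one_le) (auto simp: line_def)
    then show ?thesis using False t width_nonneg[of ?x] by (simp add: ray_def abs_mult)
  qed
  then show ?thesis using x t by (simp add: strip_def ray_def)
qed

text \<open>The vertical displacement is the change of \<open>s\<close> times a width of at most a third of the horizontal
  distance \<open>D\<close>, plus a change of width of at most a twelfth of \<open>D\<close>. As \<open>s\<close> changes by at most 2, this
  is at most \<open>3/4\<close> of the horizontal displacement, so the path is a geodesic of length \<open>D\<close>.\<close>

lemma far_dist:
  assumes p: "p \<in> strip" and q: "q \<in> params" and far: "\<not> near (fst p) (fst q)"
    and t: "r \<in> {0..1}" "s \<in> {0..1}"
  shows "box_dist (ray p q r) (ray p q s) = \<bar>r - s\<bar> * \<bar>fst p - fst q\<bar>"
proof -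
  define D where "D = \<bar>fst q - fst p\<bar>"
  define \<sigma> where "\<sigma> = snd p / width (fst p)"
  let ?x = "line (fst p) (fst q)" and ?s = "line \<sigma> (snd q)"
  have dx: "\<bar>?x r - ?x s\<bar> = \<bar>r - s\<bar> * D"
    by (simp add: line_diff abs_mult D_def)
  have "\<bar>?x r - fst p\<bar> \<le> D"
    using line_diff[of "fst p" "fst q" r 0] t(1)
    by (auto simp: line_def abs_mult D_def intro!: mult_left_le_one_le)
  then have w: "width (?x r) \<le> D / 3"
    using far width_le_add[of "?x r" "fst p"] by (simp add: near_def D_def)
  have "\<bar>snd q - \<sigma>\<bar> \<le> 2"
    using strip_ratio(1)[OF p, folded \<sigma>_def] q by (auto simp: params_def abs_le_iff)
  then have "\<bar>(?s r - ?s s) * width (?x r)\<bar> \<le> (\<bar>r - s\<bar> * 2) * (D / 3)"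
    using w width_nonneg[of "?x r"]
    unfolding line_diff abs_mult by (intro mult_mono mult_left_mono) auto
  moreover have "\<bar>?s s\<bar> \<le> line 1 1 s"
    using strip_ratio(1)[OF p] q t by (intro abs_line_le) (auto simp: params_def abs_le_iff \<sigma>_def)
  then have "\<bar>?s s * (width (?x r) - width (?x s))\<bar> \<le> 1 * (\<bar>r - s\<bar> * D / 12)"
    using width_Lipschitz[of "?x r" "?x s"] dx
    unfolding abs_mult by (intro mult_mono) (auto simp: line_def)
  moreover have "?s r * width (?x r) - ?s s * width (?x s)
      = (?s r - ?s s) * width (?x r) + ?s s * (width (?x r) - width (?x s))"
    by (simp add: algebra_simps)
  ultimately have "\<bar>?s r * width (?x r) - ?s s * width (?x s)\<bar>
      \<le> \<bar>r - s\<bar> * 2 * (D / 3) + 1 * (\<bar>r - s\<bar> * D / 12)"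
    by (simp only: order_trans[OF abs_triangle_ineq add_mono])
  then have "\<bar>?s r * width (?x r) - ?s s * width (?x s)\<bar> \<le> 3/4 * (\<bar>r - s\<bar> * D)"
    by (simp add: mult.commute)
  moreover have "0 \<le> \<bar>r - s\<bar> * D" by (simp add: D_def)
  ultimately have "\<bar>?s r * width (?x r) - ?s s * width (?x s)\<bar> \<le> \<bar>r - s\<bar> * D" by linarith
  then show ?thesis
    using far t dx
    by (simp add: ray_def box_dist_def \<sigma>_def D_def abs_minus_commute max_absorb1)
qed

lemma near_dist:
  assumes near: "near (fst p) (fst q)" and t: "r \<in> {0..1}" "s \<in> {0..1}"
  shows "box_dist (ray p q r) (ray p q s) = \<bar>r - s\<bar> * box_dist p (param q)"
  using near t
  by (simp add: ray_def box_dist_def line_diff abs_mult param_def max_mult_distrib_left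
      abs_minus_commute)

lemma ray_dist:
  assumes p: "p \<in> strip" and q: "q \<in> params" and t: "r \<in> {0..1}" "s \<in> {0..1}"
  shows "box_dist (ray p q r) (ray p q s) = \<bar>r - s\<bar> * box_dist p (param q)"
proof (cases "near (fst p) (fst q)")
  case False
  then show ?thesis
    using far_dist[OF p q False t] far_dist[OF p q False, of 0 1] ray_0[OF p] ray_1[of p q] by simp
qed (use near_dist t in blast)

lemma ray_in_Geo:
  assumes "p \<in> strip" "q \<in> params"
  shows "ray p q \<in> Geo strip_metric"
proof -
  have "ray p q \<in> {0..1} \<rightarrow>\<^sub>E strip"
    using ray_in_strip[OF assms] by (auto simp: ray_def)
  then show ?thesis
    using ray_dist[OF assms] ray_0[OF assms(1)] ray_1[of p q] by (simp add: Geo_def)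
qed

lemma geo_length_ray:
  assumes "p \<in> strip"
  shows "geo_length strip_metric (ray p q) = box_dist p (param q)"
  using ray_0[OF assms] ray_1[of p q] by (simp add: geo_length_def)

lemma width_le:
  assumes "0 \<le> x" "x \<le> 1/2" shows "width x \<le> x / 12" "width x \<le> (1/2 - x) / 12"
  using width_le_cut[OF cut_0, of x] width_le_cut[OF cut_half, of x] assms by auto

lemma box_dist_le_half:
  assumes "p \<in> strip" "q \<in> strip"
  shows "box_dist p q \<le> 1/2"
proof -
  have "width (fst p) \<le> 1/4" "width (fst q) \<le> 1/4"
    using assms width_le[of "fst p"] width_le[of "fst q"] by (auto simp: strip_def)
  then have "\<bar>snd p - snd q\<bar> \<le> 1/4 + 1/4"
    using assms by (intro order_trans[OF abs_triangle_ineq4] add_mono) (auto simp: strip_def)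
  moreover have "\<bar>fst p - fst q\<bar> \<le> 1/2"
    using assms unfolding abs_le_iff by (simp add: strip_def)
  ultimately show ?thesis by (simp add: box_dist_def)
qed

text \<open>For a fixed start, \<open>ray\<close> jumps where the end point changes from near to far. It is Lipschitz on
  each of the two pieces, which suffices for measurability.\<close>

lemma ray_Lipschitz:
  assumes p: "p \<in> strip" and q: "q \<in> params" "q' \<in> params" and t: "t \<in> {0..1}"
    and same: "near (fst p) (fst q) = near (fst p) (fst q')"
  shows "box_dist (ray p q t) (ray p q' t) \<le> 2 * dist q q'"
proof -
  let ?x = "line (fst p) (fst q) t" and ?x' = "line (fst p) (fst q') t"
  have key: "\<bar>s * width x - s' * width x'\<bar> \<le> \<bar>s - s'\<bar> + \<bar>x - x'\<bar>"
    if "x \<in> {0..1/2}" "\<bar>s'\<bar> \<le> 1" for s s' x x'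
  proof -
    have "s * width x - s' * width x' = (s - s') * width x + s' * (width x - width x')"
      by (simp add: algebra_simps)
    also have "\<bar>\<dots>\<bar> \<le> \<bar>s - s'\<bar> * \<bar>width x\<bar> + \<bar>s'\<bar> * \<bar>width x - width x'\<bar>"
      by (metis abs_mult abs_triangle_ineq)
    also have "\<dots> \<le> \<bar>s - s'\<bar> * 1 + 1 * \<bar>x - x'\<bar>"
      using that width_le[of x] width_nonneg[of x]
        order_trans[OF width_Lipschitz[of x x'], of "\<bar>x - x'\<bar>"]
      by (intro add_mono mult_mono) auto
    finally show ?thesis by simp
  qed
  have dq: "\<bar>fst q - fst q'\<bar> \<le> dist q q'" "\<bar>snd q - snd q'\<bar> \<le> dist q q'"
    using dist_fst_le[of q q'] dist_snd_le[of q q'] by (simp_all add: dist_real_def)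
  have tle: "\<bar>t * u\<bar> \<le> \<bar>u\<bar>" for u :: real
    using t by (simp add: abs_mult mult_left_le_one_le)
  have 1: "\<bar>?x - ?x'\<bar> \<le> \<bar>fst q - fst q'\<bar>"
    unfolding line_diff_right by (rule tle)
  have 2: "\<bar>snd (ray p q t) - snd (ray p q' t)\<bar> \<le> \<bar>snd q - snd q'\<bar> + \<bar>fst q - fst q'\<bar>"
  proof (cases "near (fst p) (fst q)")
    case True
    then have "snd (ray p q t) - snd (ray p q' t)
        = t * (snd q * width (fst q) - snd q' * width (fst q'))"
      using same t by (simp add: ray_def line_diff_right param_def)
    also have "\<bar>\<dots>\<bar> \<le> \<bar>snd q * width (fst q) - snd q' * width (fst q')\<bar>" by (rule tle)
    also have "\<dots> \<le> \<bar>snd q - snd q'\<bar> + \<bar>fst q - fst q'\<bar>"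
      using q by (intro key) (auto simp: params_def)
    finally show ?thesis .
  next
    case False
    let ?s = "line (snd p / width (fst p)) (snd q) t"
    let ?s' = "line (snd p / width (fst p)) (snd q') t"
    have "\<bar>?s'\<bar> \<le> line 1 1 t"
      using strip_ratio(1)[OF p] q t by (intro abs_line_le) (auto simp: params_def abs_le_iff)
    moreover have "?x \<in> {0..1/2}"
      using p q t by (intro line_in_interval) (auto simp: strip_def params_def)
    ultimately have "\<bar>?s * width ?x - ?s' * width ?x'\<bar> \<le> \<bar>?s - ?s'\<bar> + \<bar>?x - ?x'\<bar>"
      by (intro key) (auto simp: line_def)
    also have "\<dots> \<le> \<bar>snd q - snd q'\<bar> + \<bar>fst q - fst q'\<bar>"
      unfolding line_diff_right by (intro add_mono tle)
    finally show ?thesis using False same t by (simp add: ray_def)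
  qed
  have "\<bar>fst (ray p q t) - fst (ray p q' t)\<bar> \<le> \<bar>fst q - fst q'\<bar>"
    using 1 t by (simp add: ray_def)
  then show ?thesis using 2 dq unfolding box_dist_def by linarith
qed

text \<open>In the parameters, contraction towards \<open>p\<close> acts on each fibre by an affine map with the
  following slope and offset.\<close>

definition slope :: "real \<Rightarrow> real \<Rightarrow> real \<Rightarrow> real"
  where "slope a t x = (if near a x then t * width x / width (line a x t) else t)"

definition offset :: "real \<times> real \<Rightarrow> real \<Rightarrow> real \<Rightarrow> real"
  where "offset p t x = (1 - t) * snd p / width (if near (fst p) x then line (fst p) x t else fst p)"

lemma ray_affine:
  assumes "t \<in> {0..1}"
  shows "ray p q t = param (line (fst p) (fst q) t, offset p t (fst q) + slope (fst p) t (fst q) * snd q)"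
proof (cases "near (fst p) (fst q)")
  case True
  then have "width (line (fst p) (fst q) t) > 0"
    using near_width near_line[OF True assms] by force
  then show ?thesis
    using True assms by (simp add: ray_def param_def slope_def offset_def line_def field_simps)
next
  case False
  then show ?thesis
    using assms by (simp add: ray_def param_def slope_def offset_def line_def)
qed

lemma ray_affine_in_params:
  assumes p: "p \<in> strip" and q: "q \<in> params" and t: "t \<in> {0..1}"
  shows "(line (fst p) (fst q) t, offset p t (fst q) + slope (fst p) t (fst q) * snd q) \<in> params"
proof -
  let ?x = "line (fst p) (fst q) t"
  let ?s = "offset p t (fst q) + slope (fst p) t (fst q) * snd q"
  have x: "?x \<in> {0..1/2}"
    using p q t by (intro line_in_interval) (auto simp: strip_def params_def)
  have "\<bar>?s\<bar> \<le> 1"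
  proof (cases "near (fst p) (fst q)")
    case True
    then have w: "width ?x > 0"
      using near_width near_line[OF True t] by force
    have "\<bar>?s\<bar> * width ?x \<le> width ?x"
      using ray_in_strip[OF p q t] w unfolding ray_affine[OF t]
      by (simp add: strip_def param_def abs_mult)
    then show ?thesis using w by simp
  next
    case False
    have "\<bar>line (snd p / width (fst p)) (snd q) t\<bar> \<le> line 1 1 t"
      using strip_ratio(1)[OF p] q t by (intro abs_line_le) (auto simp: params_def abs_le_iff)
    then show ?thesis using False by (simp add: line_def slope_def offset_def)
  qed
  then show ?thesis using x by (auto simp: params_def abs_le_iff)
qed

text \<open>Since the width is Lipschitz and drops by at most a third over the near points, a near point has
  \<open>width (line a x t) \<le> width x * (3 - t) / 2\<close>; and \<open>(1 + t) * (3 - t) \<le> 4\<close>.\<close>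

lemma slope_ge:
  assumes t: "0 < t" "t \<le> 1"
  shows "t * (1 + t) / 2 \<le> slope a t x"
proof (cases "near a x")
  case True
  let ?x = "line a x t"
  have w: "width ?x > 0"
    using near_width near_line[OF True, of t] t by force
  have "\<bar>?x - x\<bar> = (1 - t) * \<bar>x - a\<bar>"
    using t line_diff_end[of x a t] by (metis abs_minus_commute abs_mult abs_of_nonneg diff_ge_0_iff_ge)
  also have "\<dots> \<le> (1 - t) * (4 * width a)"
    using True t by (intro mult_left_mono) (auto simp: near_def)
  also have "\<dots> \<le> (1 - t) * (6 * width x)"
    using near_width[OF True] t by (intro mult_left_mono) auto
  finally have "width ?x \<le> width x + (1 - t) * width x / 2"
    using width_le_add[of ?x x] by simp
  then have "width ?x \<le> width x * ((3 - t) / 2)" by (simp add: field_simps)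
  then have "(1 + t) / 2 * width ?x \<le> (1 + t) / 2 * (width x * ((3 - t) / 2))"
    using t by (intro mult_left_mono) auto
  also have "\<dots> = width x * (((1 + t) * (3 - t)) / 4)" by simp
  also have "\<dots> \<le> width x * 1"
  proof (intro mult_left_mono width_nonneg)
    have "0 \<le> (1 - t)\<^sup>2" by simp
    then show "(1 + t) * (3 - t) / 4 \<le> 1" by (simp add: power2_eq_square algebra_simps)
  qed
  finally have "(1 + t) / 2 \<le> width x / width ?x" using w by (simp add: field_simps)
  then have "t * ((1 + t) / 2) \<le> t * (width x / width ?x)"
    using t by (intro mult_left_mono) auto
  then show ?thesis using True by (simp add: slope_def)
next
  case False
  have "t * (1 + t) / 2 \<le> t" using t by (simp add: field_simps)
  then show ?thesis using False by (simp add: slope_def)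
qed

text \<open>The difference of the two sides is a convex function of \<open>t\<close> that vanishes at 0 and 1: its second
  derivative is \<open>2 * l\<^sup>2 * cos (2 * t * l) - (sin l)\<^sup>2\<close>, and the cosine is at least 1/2.\<close>

lemma sin_ratio_le:
  fixes l t :: real
  assumes l: "0 < l" "l \<le> 1/2" and t: "0 \<le> t" "t \<le> 1"
  shows "(sin (t * l))\<^sup>2 \<le> t * (1 + t) / 2 * (sin l)\<^sup>2"
proof -
  define k where "k = (\<lambda>t. (sin (t * l))\<^sup>2 - t * (1 + t) / 2 * (sin l)\<^sup>2)"
  define k' where "k' = (\<lambda>t. l * sin (2 * t * l) - (1 + 2 * t) / 2 * (sin l)\<^sup>2)"
  define k'' where "k'' = (\<lambda>t. 2 * l\<^sup>2 * cos (2 * t * l) - (sin l)\<^sup>2)"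
  have "convex_on {0..1} k"
  proof (rule f''_ge0_imp_convex)
    fix x :: real assume x: "x \<in> {0..1}"
    have sin_2xl: "sin (2 * x * l) = 2 * sin (x * l) * cos (x * l)"
      using sin_double[of "x * l"] by (simp add: mult.assoc)
    show "(k has_real_derivative k' x) (at x)"
      unfolding k_def k'_def sin_2xl
      by (auto intro!: derivative_eq_intros simp: algebra_simps add_divide_distrib)
    show "(k' has_real_derivative k'' x) (at x)"
      unfolding k'_def k''_def
      by (auto intro!: derivative_eq_intros simp: algebra_simps power2_eq_square)
    \<comment> \<open>The cosine bound follows from \<open>1 \<le> pi / 3\<close>.\<close>
    have "2 * x * l \<le> 1" using x l mult_mono[of x 1 l "1/2"] by auto
    then have "cos (pi / 3) \<le> cos (2 * x * l)"
      using x l pi_gt3 by (intro cos_monotone_0_pi_le) auto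
    then have "l\<^sup>2 * (1/2) \<le> l\<^sup>2 * cos (2 * x * l)"
      by (intro mult_left_mono) (auto simp: cos_60)
    moreover have "\<bar>sin l\<bar> \<le> \<bar>l\<bar>" by (rule abs_sin_x_le_abs_x)
    then have "(sin l)\<^sup>2 \<le> l\<^sup>2" by (simp add: abs_le_square_iff)
    ultimately show "0 \<le> k'' x" by (simp add: k''_def)
  qed simp
  then have "k ((1 - t) *\<^sub>R 0 + t *\<^sub>R 1) \<le> (1 - t) * k 0 + t * k 1"
    using t by (intro convex_onD) auto
  then show ?thesis by (simp add: k_def)
qed

lemma mcp_coeff_le:
  assumes l: "0 \<le> l" "l \<le> 1/2" and t: "0 \<le> t" "t \<le> 1"
  shows "mcp_coeff t l \<le> t * (t * (1 + t) / 2)"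
proof (cases "l = 0")
  case True
  have "t\<^sup>2 \<le> t" using t by (simp add: power2_eq_square mult_left_le_one_le)
  then have "t\<^sup>2 \<le> t * (1 + t) / 2" by (simp add: power2_eq_square algebra_simps)
  then have "t * t\<^sup>2 \<le> t * (t * (1 + t) / 2)" using t by (intro mult_left_mono)
  then show ?thesis using True by (simp add: mcp_coeff_def)
next
  case False
  then have "sin l > 0" using l pi_gt3 by (intro sin_gt_zero) auto
  then have "(sin (t * l))\<^sup>2 / (sin l)\<^sup>2 \<le> t * (1 + t) / 2"
    using sin_ratio_le[of l t] False l t by (simp add: pos_divide_le_eq)
  then have "t * ((sin (t * l))\<^sup>2 / (sin l)\<^sup>2) \<le> t * (t * (1 + t) / 2)"
    using t by (intro mult_left_mono)
  then show ?thesis using False by (simp add: mcp_coeff_def)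
qed

section \<open>Borel sigma-algebras of topologies\<close>

lemma space_borel_sigma [simp]: "space (borel_sigma T) = topspace T"
  by (simp add: borel_sigma_def space_measure_of_conv)

lemma sets_borel_sigma: "sets (borel_sigma T) = sigma_sets (topspace T) {U. openin T U}"
  unfolding borel_sigma_def by (rule sets_measure_of) (auto dest: openin_subset)

lemma openin_borel_sigma: "openin T U \<Longrightarrow> U \<in> sets (borel_sigma T)"
  unfolding sets_borel_sigma by (rule sigma_sets.Basic) simp

lemma measurable_into_borel_sigma:
  assumes "f \<in> space M \<rightarrow> topspace T" "\<And>U. openin T U \<Longrightarrow> f -` U \<inter> space M \<in> sets M"
  shows "f \<in> measurable M (borel_sigma T)"
  using assms by (intro measurable_sigma_sets[OF sets_borel_sigma]) (auto dest: openin_subset)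

lemma measurable_borel_sigma:
  assumes "continuous_map S T f"
  shows "f \<in> measurable (borel_sigma S) (borel_sigma T)"
proof (rule measurable_into_borel_sigma)
  show "f \<in> space (borel_sigma S) \<rightarrow> topspace T"
    using continuous_map_funspace[OF assms] by simp
  fix U assume "openin T U"
  then have "openin S {x \<in> topspace S. f x \<in> U}"
    by (rule openin_continuous_map_preimage[OF assms])
  moreover have "f -` U \<inter> space (borel_sigma S) = {x \<in> topspace S. f x \<in> U}" by auto
  ultimately show "f -` U \<inter> space (borel_sigma S) \<in> sets (borel_sigma S)"
    by (simp add: openin_borel_sigma)
qed

lemma sets_borel_sigma_top_of_set:
  assumes "S \<in> sets borel"
  shows "sets (borel_sigma (top_of_set S)) = sets (restrict_space borel S)"
proof -
  have "sets (restrict_space borel S) = (\<inter>) S ` sigma_sets UNIV {U. open U}"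
    by (simp add: sets_restrict_space borel_def)
  also have "\<dots> = sigma_sets S ((\<inter>) S ` {U. open U})"
    using assms by (intro sigma_sets_Int) (simp_all add: borel_def)
  also have "(\<inter>) S ` {U. open U} = {U. openin (top_of_set S) U}"
    by (auto simp: openin_open)
  finally show ?thesis by (simp add: sets_borel_sigma)
qed

lemma separable_space_top_of_set:
  "separable_space (top_of_set (S :: 'a::{metric_space, second_countable_topology} set))"
proof -
  obtain T where "countable T" "T \<subseteq> S" "S \<subseteq> closure T" by (rule separable)
  then show ?thesis
    unfolding separable_space_def
    by (intro exI[of _ T]) (auto simp: closure_of_subtopology Int_absorb1)
qed

section \<open>Evaluation of geodesics\<close>

lemma Geo_metric:
  "mspace (metric (Geo X, geo_dist X)) = Geo X"
  "mdist (metric (Geo X, geo_dist X)) = geo_dist X"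
  "mtopology_of (metric (Geo X, geo_dist X)) = Geo_topology X"
proof -
  interpret Metric_space "Geo X" "geo_dist X" by (rule Metric_space_Geo)
  show "mspace (metric (Geo X, geo_dist X)) = Geo X"
    "mdist (metric (Geo X, geo_dist X)) = geo_dist X"
    "mtopology_of (metric (Geo X, geo_dist X)) = Geo_topology X"
    by (simp_all add: Geo_topology_def)
qed

lemma topspace_Geo_topology [simp]: "topspace (Geo_topology X) = Geo X"
  using topspace_mtopology_of[of "metric (Geo X, geo_dist X)"] by (simp only: Geo_metric)

lemma continuous_map_eval:
  assumes t: "t \<in> {0..1}"
  shows "continuous_map (Geo_topology X) (mtopology_of X) (\<lambda>\<gamma>. \<gamma> t)"
proof -
  have "mdist X (\<gamma> t) (\<eta> t) \<le> geo_dist X \<gamma> \<eta>" if "\<gamma> \<in> Geo X" "\<eta> \<in> Geo X" for \<gamma> \<eta>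
    using that cSUP_upper[OF t geo_dist_bdd[OF that]] by (simp add: geo_dist_def)
  then have "Lipschitz_continuous_map (metric (Geo X, geo_dist X)) X (\<lambda>\<gamma>. \<gamma> t)"
    using Geo_mem[OF _ t] unfolding Lipschitz_continuous_map_def Geo_metric
    by (intro conjI exI[of _ 1]) auto
  then show ?thesis
    using Lipschitz_continuous_imp_continuous_map unfolding Geo_metric(3)[symmetric] by blast
qed

lemma continuous_map_geo_length:
  "continuous_map (Geo_topology X) euclideanreal (geo_length X)"
  unfolding geo_length_def by (intro continuous_map_mdist continuous_map_eval) auto

section \<open>The measure\<close>

definition param_measure :: "(real \<times> real) measure"
  where "param_measure = restrict_space lborel params"

definition strip_measure :: "(real \<times> real) measure"
  where "strip_measure = distr param_measure (restrict_space borel strip) param"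

lemma compact_params: "compact params"
  unfolding params_def by (intro compact_Times) auto

lemma params_borel [measurable]: "params \<in> sets borel"
  using compact_params by (intro borel_closed compact_imp_closed)

lemma space_param_measure [simp]: "space param_measure = params"
  by (simp add: param_measure_def space_restrict_space)

lemma sets_param_measure: "B \<in> sets param_measure \<longleftrightarrow> B \<in> sets borel \<and> B \<subseteq> params"
  unfolding param_measure_def by (subst sets_restrict_space_iff) auto

lemma emeasure_param_measure: "B \<subseteq> params \<Longrightarrow> emeasure param_measure B = emeasure lborel B"
  unfolding param_measure_def by (rule emeasure_restrict_space) auto

lemma continuous_on_param: "continuous_on S param"
  unfolding param_def by (intro continuous_intros)

lemma param_image: "param ` params = strip"
  using param_in_strip strip_subset_param by force

lemma compact_strip: "compact strip"
  unfolding param_image[symmetric] by (intro compact_continuous_image continuous_on_param compact_params)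

lemma strip_borel [measurable]: "strip \<in> sets borel"
  using compact_strip by (intro borel_closed compact_imp_closed)

lemma measurable_param [measurable]: "param \<in> measurable param_measure (restrict_space borel strip)"
proof (rule measurable_restrict_space2)
  show "param \<in> space param_measure \<rightarrow> strip" using param_in_strip by auto
  have "param \<in> borel_measurable borel"
    by (intro borel_measurable_continuous_onI continuous_on_param)
  then show "param \<in> borel_measurable param_measure"
    unfolding param_measure_def by (intro measurable_restrict_space1) simp
qed

lemma sets_strip_measure: "sets strip_measure = sets (restrict_space borel strip)"
  by (simp add: strip_measure_def)

lemma sets_strip_measure_borel_sigma:
  "sets strip_measure = sets (borel_sigma (mtopology_of strip_metric))"
  by (simp add: sets_strip_measure mtopology_strip_metric sets_borel_sigma_top_of_set)

lemma space_strip_measure [simp]: "space strip_measure = strip"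
  by (simp add: strip_measure_def space_restrict_space)

lemma measurable_param_strip: "param \<in> measurable param_measure strip_measure"
  using measurable_param measurable_cong_sets[OF refl sets_strip_measure] by blast

lemma emeasure_strip_measure:
  assumes "B \<in> sets strip_measure"
  shows "emeasure strip_measure B = emeasure param_measure (param -` B \<inter> params)"
  using assms unfolding strip_measure_def by (subst emeasure_distr) auto

lemma finite_strip_measure: "emeasure strip_measure B < \<infinity>"
proof -
  have "emeasure strip_measure B \<le> emeasure strip_measure strip"
    using emeasure_space[of strip_measure B] by simp
  also have "\<dots> = emeasure lborel (param -` strip \<inter> params)"
    using sets.top[of strip_measure] by (simp add: emeasure_strip_measure emeasure_param_measure)
  also have "\<dots> < \<infinity>"
    using compact_imp_bounded[OF compact_params]
    by (intro emeasure_bounded_finite) (auto intro: bounded_subset)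
  finally show ?thesis .
qed

lemma strip_measure_open_pos:
  assumes U: "openin (top_of_set strip) U" and p: "p \<in> U"
  shows "0 < emeasure strip_measure U"
proof -
  have "p \<in> strip" using p openin_imp_subset[OF U] by blast
  then obtain q where q: "q \<in> params" "param q = p" using strip_subset_param by blast
  have "openin (top_of_set params) (params \<inter> param -` U)"
    by (rule continuous_openin_preimage[OF continuous_on_param _ U]) (use param_in_strip in blast)
  then obtain e where e: "e > 0" "\<And>q'. q' \<in> params \<Longrightarrow> dist q' q < e \<Longrightarrow> param q' \<in> U"
  proof -
    have "q \<in> params \<inter> param -` U" using q p by simp
    then obtain e where "e > 0" "\<forall>q'\<in>params. dist q' q < e \<longrightarrow> q' \<in> params \<inter> param -` U"
      using \<open>openin (top_of_set params) (params \<inter> param -` U)\<close>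
      unfolding openin_euclidean_subtopology_iff by blast
    then show ?thesis using that by blast
  qed
  \<comment> \<open>A box of half-width \<open>d\<close> around \<open>q\<close>, cut off at the boundary of the rectangle, still has interior points.\<close>
  define d where "d = min (e / 4) (1/4)"
  obtain x s where q_eq: "q = (x, s)" by (cases q)
  define I where "I = {max 0 (x - d)..min (1/2) (x + d)}"
  define J where "J = {max (-1) (s - d)..min 1 (s + d)}"
  have d: "0 < d" "d \<le> 1/4" "d \<le> e / 4" using e(1) by (auto simp: d_def)
  have xs: "0 \<le> x" "x \<le> 1/2" "-1 \<le> s" "s \<le> 1" using q(1) by (auto simp: q_eq params_def)
  have box: "I \<times> J \<subseteq> param -` U \<inter> params"
  proof
    fix q' assume q': "q' \<in> I \<times> J"
    then have "q' \<in> params" by (auto simp: I_def J_def params_def)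
    moreover have "\<bar>fst q' - x\<bar> \<le> d" "\<bar>snd q' - s\<bar> \<le> d"
      using q' by (auto simp: I_def J_def)
    then have "box_dist q' q \<le> d" by (simp add: box_dist_def q_eq)
    then have "dist q' q < e" using dist_le_box_dist[of q' q] d e(1) by linarith
    ultimately show "q' \<in> param -` U \<inter> params" using e(2) by simp
  qed
  have U': "U \<in> sets strip_measure"
    using U by (simp add: sets_strip_measure_borel_sigma mtopology_strip_metric openin_borel_sigma)
  then have preimage: "param -` U \<inter> params \<in> sets lborel"
    using measurable_sets[OF measurable_param_strip] by (simp add: sets_param_measure)
  have "0 < emeasure lborel I" "0 < emeasure lborel J"
  proof -
    have "max 0 (x - d) < min (1/2) (x + d)" "max (-1) (s - d) < min 1 (s + d)"
      unfolding max_less_iff_conj min_less_iff_conj using d xs by auto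
    then show "0 < emeasure lborel I" "0 < emeasure lborel J"
      unfolding I_def J_def by (simp_all only: emeasure_lborel_Icc_eq) simp_all
  qed
  then have "0 < emeasure lborel I * emeasure lborel J"
    by (simp add: ennreal_zero_less_mult_iff)
  also have "\<dots> = emeasure lborel (I \<times> J)"
    unfolding lborel_prod[symmetric]
    by (rule lborel.emeasure_pair_measure_Times[symmetric]) (simp_all add: I_def J_def)
  also have "\<dots> \<le> emeasure lborel (param -` U \<inter> params)"
    by (rule emeasure_mono[OF box preimage])
  also have "\<dots> = emeasure strip_measure U"
    by (simp add: emeasure_strip_measure[OF U'] emeasure_param_measure)
  finally show ?thesis .
qed

lemma metric_measure_space_strip: "metric_measure_space strip_metric strip_measure"
  unfolding metric_measure_space_def
proof (intro conjI ballI impI)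
  interpret Metric_space strip box_dist
    using Metric_space_mspace_mdist[of strip_metric] by simp
  have mtopology: "mtopology = top_of_set strip"
    using mtopology_strip_metric by (simp add: mtopology_of_def)
  have "compact_space mtopology"
    using compact_strip by (simp add: mtopology compact_space_subtopology compactin_euclidean_iff)
  then show "mcomplete_of strip_metric"
    using compact_space_imp_mcomplete by (simp add: mcomplete_of_def)
  show "separable_space (mtopology_of strip_metric)"
    by (simp add: mtopology_strip_metric separable_space_top_of_set)
  show "sets strip_measure = sets (borel_sigma (mtopology_of strip_metric))"
    by (rule sets_strip_measure_borel_sigma)
  have "(0, 0) \<in> strip" using width_nonneg by (simp add: strip_def)
  then show "emeasure strip_measure (mspace strip_metric) \<noteq> 0"
    using strip_measure_open_pos[of strip "(0, 0)"] by simp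
  show "measure_support (mtopology_of strip_metric) strip_measure = mspace strip_metric"
    using strip_measure_open_pos by (auto simp: measure_support_def mtopology_strip_metric)
qed (use finite_strip_measure in simp)

section \<open>The measure contraction property\<close>

text \<open>A fibre-preserving map that scales the base by \<open>t\<close> and each fibre by at least \<open>\<alpha>\<close> does not
  concentrate Lebesgue measure by more than \<open>1 / (t * \<alpha>)\<close>. The fibre maps may vary discontinuously
  with the base point, and they may reverse orientation.\<close>

lemma sheared_contraction_integral:
  fixes I :: "real set" and c :: real
  assumes [measurable]: "B \<in> sets borel" "I \<in> sets borel" "a \<in> borel_measurable borel"
      "b \<in> borel_measurable borel"
    and t: "0 < t" and \<alpha>: "0 < \<alpha>" "\<And>x. x \<in> I \<Longrightarrow> \<alpha> \<le> \<bar>a x\<bar>"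
  shows "ennreal (t * \<alpha>) * (\<integral>\<^sup>+q. indicator I (fst q) *
      indicator B (c + t * fst q, b (fst q) + a (fst q) * snd q) \<partial>lborel) \<le> emeasure lborel B"
proof -
  define slice :: "real \<Rightarrow> ennreal" where "slice x = (\<integral>\<^sup>+s. indicator B (x, s) \<partial>lborel)" for x
  have B [measurable]: "B \<in> sets (borel \<Otimes>\<^sub>M borel)"
    using assms(1) by (simp only: borel_prod)
  have [measurable]: "slice \<in> borel_measurable borel"
    unfolding slice_def by measurable
  have slice_le: "ennreal \<alpha> * (\<integral>\<^sup>+s. indicator I x * indicator B (c + t * x, b x + a x * s) \<partial>lborel)
      \<le> slice (c + t * x)" for x
  proof (cases "x \<in> I")
    case True
    then have nz: "a x \<noteq> 0" using \<alpha> by force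
    have "slice (c + t * x)
        = ennreal \<bar>a x\<bar> * (\<integral>\<^sup>+s. indicator B (c + t * x, b x + a x * s) \<partial>lborel)"
      unfolding slice_def using nz
      by (intro nn_integral_real_affine[where f = "\<lambda>s. indicator B (c + t * x, s)"]) auto
    then show ?thesis
      using True \<alpha>(2)[OF True] by (simp add: mult_right_mono ennreal_leI)
  qed simp
  have "(\<integral>\<^sup>+q. indicator I (fst q) * indicator B (c + t * fst q, b (fst q) + a (fst q) * snd q) \<partial>lborel)
     = (\<integral>\<^sup>+x. \<integral>\<^sup>+s. indicator I x * indicator B (c + t * x, b x + a x * s) \<partial>lborel \<partial>lborel)"
    unfolding lborel_prod[symmetric]
    by (subst lborel.nn_integral_fst[symmetric]) auto
  also have "ennreal (t * \<alpha>) * \<dots> = ennreal t * (\<integral>\<^sup>+x. ennreal \<alpha> *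
      (\<integral>\<^sup>+s. indicator I x * indicator B (c + t * x, b x + a x * s) \<partial>lborel) \<partial>lborel)"
    using t \<alpha> by (subst nn_integral_cmult) (auto simp: ennreal_mult mult.assoc)
  also have "\<dots> \<le> ennreal t * (\<integral>\<^sup>+x. slice (c + t * x) \<partial>lborel)"
    using slice_le by (intro mult_left_mono nn_integral_mono) auto
  also have "\<dots> = (\<integral>\<^sup>+x. slice x \<partial>lborel)"
    using t nn_integral_real_affine[of slice t c] by simp
  also have "\<dots> = emeasure lborel B"
    unfolding slice_def lborel_prod[symmetric]
    by (subst lborel.nn_integral_fst) auto
  finally show ?thesis .
qed

lemma measurable_slope [measurable]: "slope a t \<in> borel_measurable borel"
  unfolding slope_def near_def line_def by measurable

lemma measurable_offset [measurable]: "offset p t \<in> borel_measurable borel"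
  unfolding offset_def near_def line_def if_distrib[of width] by measurable

text \<open>The parameters split into the near and the far ones, and on each of these sets the preimage of
  an open set of geodesics is relatively open.\<close>

lemma measurable_ray:
  assumes p: "p \<in> strip"
  shows "ray p \<in> measurable param_measure (borel_sigma (Geo_topology strip_metric))"
proof (rule measurable_into_borel_sigma)
  show "ray p \<in> space param_measure \<rightarrow> topspace (Geo_topology strip_metric)"
    using ray_in_Geo[OF p] by auto
  fix U assume U: "openin (Geo_topology strip_metric) U"
  interpret G: Metric_space "Geo strip_metric" "geo_dist strip_metric" by (rule Metric_space_Geo)
  have ray_near: "geo_dist strip_metric (ray p q) (ray p q') \<le> 2 * dist q q'"
    if "q \<in> params" "q' \<in> params" "near (fst p) (fst q) = near (fst p) (fst q')" for q q'
  proof -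
    have "(SUP t\<in>{0..1}. box_dist (ray p q t) (ray p q' t)) \<le> 2 * dist q q'"
      using ray_Lipschitz[OF p that(1,2) _ that(3)] by (intro cSUP_least) simp_all
    then show ?thesis
      using ray_in_Geo[OF p that(1)] ray_in_Geo[OF p that(2)] by (simp add: geo_dist_def)
  qed
  have piece: "{q \<in> S. ray p q \<in> U} \<in> sets borel"
    if S: "S \<in> sets borel" "S \<subseteq> params"
      and same: "\<And>q q'. q \<in> S \<Longrightarrow> q' \<in> S \<Longrightarrow> near (fst p) (fst q) = near (fst p) (fst q')" for S
  proof -
    have "openin (top_of_set S) {q \<in> S. ray p q \<in> U}"
      unfolding openin_euclidean_subtopology_iff
    proof (intro conjI ballI)
      fix q assume q: "q \<in> {q \<in> S. ray p q \<in> U}"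
      then obtain r where r: "r > 0" "G.mball (ray p q) r \<subseteq> U"
        using U unfolding Geo_topology_def G.openin_mtopology by blast
      have "ray p q' \<in> U" if "q' \<in> S" "dist q' q < r / 2" for q'
      proof -
        have "geo_dist strip_metric (ray p q) (ray p q') < r"
          using ray_near[of q q'] same[of q q'] q that S(2) by (force simp: dist_commute)
        moreover have "q \<in> params" "q' \<in> params" using q that(1) S(2) by blast+
        ultimately have "ray p q' \<in> G.mball (ray p q) r"
          by (simp add: ray_in_Geo[OF p])
        then show ?thesis using r(2) by blast
      qed
      then show "\<exists>e>0. \<forall>q'\<in>S. dist q' q < e \<longrightarrow> q' \<in> {q \<in> S. ray p q \<in> U}"
        using r(1) by (intro exI[of _ "r / 2"]) auto
    qed auto
    then show ?thesis using S(1) by (auto simp: openin_open)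
  qed
  have [measurable]: "{q. near (fst p) (fst q)} \<in> sets borel"
    unfolding near_def by (intro borel_open open_Collect_less continuous_intros)
  have "ray p -` U \<inter> params = {q \<in> params \<inter> {q. near (fst p) (fst q)}. ray p q \<in> U}
      \<union> {q \<in> params - {q. near (fst p) (fst q)}. ray p q \<in> U}"
    by blast
  also have "\<dots> \<in> sets borel" by (intro sets.Un piece) auto
  finally show "ray p -` U \<inter> space param_measure \<in> sets param_measure"
    by (simp add: sets_param_measure)
qed

lemma contraction_along_rays:
  assumes p: "p \<in> strip" and t: "0 \<le> t" "t \<le> 1" and B: "B \<in> sets strip_measure"
  shows "ennreal (t * (t * (1 + t) / 2)) * emeasure param_measure {q \<in> params. ray p q t \<in> B}
    \<le> emeasure strip_measure B"
proof (cases "t = 0")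
  case False
  let ?B = "param -` B \<inter> params"
  let ?f = "\<lambda>q. indicator {0..1/2} (fst q) * indicator ?B
      ((1 - t) * fst p + t * fst q, offset p t (fst q) + slope (fst p) t (fst q) * snd q) :: ennreal"
  have B': "?B \<in> sets borel"
    using measurable_sets[OF measurable_param_strip B] by (simp add: sets_param_measure)
  have "{q \<in> params. ray p q t \<in> B} \<in> sets borel"
  proof -
    have "(\<lambda>q. ray p q t) \<in> measurable param_measure (borel_sigma (mtopology_of strip_metric))"
      using measurable_compose[OF measurable_ray[OF p] measurable_borel_sigma[OF continuous_map_eval]] t
      by simp
    from measurable_sets[OF this, of B]
    show ?thesis
      using B by (simp add: sets_strip_measure_borel_sigma sets_param_measure vimage_def Int_def conj_commute)
  qed
  then have "emeasure param_measure {q \<in> params. ray p q t \<in> B}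
      = (\<integral>\<^sup>+q. indicator {q \<in> params. ray p q t \<in> B} q \<partial>lborel)"
    by (subst emeasure_param_measure) auto
  also have "\<dots> \<le> (\<integral>\<^sup>+q. ?f q \<partial>lborel)"
  proof (rule nn_integral_mono)
    fix q :: "real \<times> real"
    show "indicator {q \<in> params. ray p q t \<in> B} q \<le> ?f q"
    proof (cases "q \<in> params \<and> ray p q t \<in> B")
      case True
      then have "?f q = 1"
        using ray_affine_in_params[OF p, of q t] ray_affine[of t p q] t
        by (auto simp: line_def params_def)
      moreover have "indicator {q \<in> params. ray p q t \<in> B} q \<le> (1 :: ennreal)"
        by (simp add: indicator_def)
      ultimately show ?thesis by (simp only:)
    qed simp
  qed
  finally have "ennreal (t * (t * (1 + t) / 2)) * emeasure param_measure {q \<in> params. ray p q t \<in> B}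
      \<le> ennreal (t * (t * (1 + t) / 2)) * (\<integral>\<^sup>+q. ?f q \<partial>lborel)"
    by (rule mult_left_mono) simp
  also have "\<dots> \<le> emeasure lborel ?B"
    using False t B' slope_ge[of t, THEN order_trans[OF _ abs_ge_self]]
    by (intro sheared_contraction_integral) auto
  finally show ?thesis
    using B by (simp add: emeasure_strip_measure emeasure_param_measure)
qed simp

text \<open>The transport plan is the law of \<open>ray p q\<close> for \<open>q\<close> uniformly distributed over the parameters of
  points of \<open>A\<close>. The factor \<open>\<mu> A\<close> in the condition cancels the normalisation of this law, and what
  remains is the estimate for contraction along rays.\<close>

lemma MCP_strip: "MCP_2_3 strip_metric strip_measure"
  unfolding MCP_2_3_def
proof (intro conjI ballI impI metric_measure_space_strip)
  fix p A
  assume "p \<in> mspace strip_metric" and A: "A \<in> sets strip_measure"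
    and "0 < emeasure strip_measure A \<and> emeasure strip_measure A < \<infinity>
      \<and> A \<subseteq> mball_of strip_metric p pi"
  then have p: "p \<in> strip" and m: "emeasure strip_measure A \<noteq> 0" "emeasure strip_measure A \<noteq> \<infinity>"
    by auto
  let ?A = "param -` A \<inter> params" and ?G = "borel_sigma (Geo_topology strip_metric)"
  let ?m = "emeasure strip_measure A"
  have A': "?A \<in> sets param_measure"
    using measurable_sets[OF measurable_param_strip A] by simp
  have mA: "emeasure param_measure ?A = ?m" using emeasure_strip_measure[OF A] by simp
  define U where "U = uniform_measure param_measure ?A"
  interpret U: prob_space U
    unfolding U_def using m mA by (intro prob_space_uniform_measure) auto
  have U_measurable: "measurable U N = measurable param_measure N" for N
    unfolding U_def by (intro measurable_cong_sets) auto
  have ray: "ray p \<in> measurable U ?G"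
    using measurable_ray[OF p] by (simp add: U_measurable)
  have eval: "(\<lambda>\<gamma>. \<gamma> t) \<in> measurable ?G strip_measure" if "t \<in> {0..1}" for t
    using measurable_borel_sigma[OF continuous_map_eval[OF that]]
      measurable_cong_sets[OF refl sets_strip_measure_borel_sigma] by blast
  define P where "P = distr U ?G (ray p)"
  have setsP: "sets P = sets ?G" by (simp add: P_def)
  have eval_P: "distr P strip_measure (\<lambda>\<gamma>. \<gamma> t) = distr U strip_measure (\<lambda>q. ray p q t)"
    if "t \<in> {0..1}" for t
    unfolding P_def distr_distr[OF eval[OF that] ray] by (simp add: comp_def)
  have start: "distr P strip_measure (\<lambda>\<gamma>. \<gamma> 0) = return strip_measure p"
    using eval_P[of 0] p by (simp add: ray_0 U.distr_const)
  have "distr U strip_measure param = uniform_measure strip_measure A"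
  proof (rule measure_eqI)
    fix B assume "B \<in> sets (distr U strip_measure param)"
    then have B: "B \<in> sets strip_measure" by simp
    have "emeasure (distr U strip_measure param) B = emeasure U (param -` B \<inter> params)"
      using B measurable_param_strip by (subst emeasure_distr) (auto simp: U_measurable U_def)
    also have "\<dots> = emeasure param_measure (?A \<inter> (param -` B \<inter> params)) / ?m"
      using A' measurable_sets[OF measurable_param_strip B] mA by (simp add: U_def)
    also have "?A \<inter> (param -` B \<inter> params) = param -` (A \<inter> B) \<inter> params" by blast
    also have "emeasure param_measure \<dots> = emeasure strip_measure (A \<inter> B)"
      using A B by (simp add: emeasure_strip_measure)
    finally show "emeasure (distr U strip_measure param) B = emeasure (uniform_measure strip_measure A) B"
      using A B by simp
  qed simp
  then have finish: "distr P strip_measure (\<lambda>\<gamma>. \<gamma> 1) = uniform_measure strip_measure A"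
    using eval_P[of 1] by (simp add: ray_1)
  have bound: "emeasure (distr (density P (\<lambda>\<gamma>. ennreal (mcp_coeff t (geo_length strip_metric \<gamma>)) * ?m))
      strip_measure (\<lambda>\<gamma>. \<gamma> t)) B \<le> emeasure strip_measure B"
    if t: "t \<in> {0..1}" and B: "B \<in> sets strip_measure" for t B
  proof -
    let ?w = "\<lambda>\<gamma>. ennreal (mcp_coeff t (geo_length strip_metric \<gamma>)) * ?m"
    let ?E = "(\<lambda>\<gamma>. \<gamma> t) -` B \<inter> space ?G"
    let ?c = "ennreal (t * (t * (1 + t) / 2))"
    let ?C = "{q \<in> params. ray p q t \<in> B}"
    have "geo_length strip_metric \<in> measurable ?G (borel_sigma euclideanreal)"
      by (intro measurable_borel_sigma continuous_map_geo_length)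
    moreover have "sets (borel_sigma euclideanreal) = sets borel"
      by (simp add: sets_borel_sigma borel_def)
    ultimately have [measurable]: "geo_length strip_metric \<in> borel_measurable ?G"
      using measurable_cong_sets[OF refl] by blast
    have w [measurable]: "?w \<in> borel_measurable ?G"
      unfolding mcp_coeff_def by measurable
    have E [measurable]: "?E \<in> sets ?G" using measurable_sets[OF eval[OF t] B] .
    have wE: "(\<lambda>\<gamma>. ?w \<gamma> * indicator ?E \<gamma>) \<in> borel_measurable ?G"
      by (rule borel_measurable_times_ennreal[OF w borel_measurable_indicator[OF E]])
    have C: "?C \<in> sets param_measure"
      using measurable_sets[OF measurable_compose[OF measurable_ray[OF p] eval[OF t]] B]
      by (simp add: vimage_def Int_def conj_commute)
    have "emeasure (distr (density P ?w) strip_measure (\<lambda>\<gamma>. \<gamma> t)) B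
        = emeasure (density P ?w) ?E"
      using eval[OF t] B sets_eq_imp_space_eq[OF setsP]
      by (subst emeasure_distr) (auto simp: measurable_cong_sets[OF setsP refl])
    also have "\<dots> = (\<integral>\<^sup>+\<gamma>. ?w \<gamma> * indicator ?E \<gamma> \<partial>P)"
      using w E by (intro emeasure_density) (auto simp: setsP measurable_cong_sets[OF setsP refl])
    also have "\<dots> = (\<integral>\<^sup>+q. ?w (ray p q) * indicator ?E (ray p q) \<partial>U)"
      unfolding P_def using wE by (intro nn_integral_distr ray) (simp only: measurable_distr_eq1)
    also have "\<dots> = (\<integral>\<^sup>+q. ?w (ray p q) * indicator ?E (ray p q) * indicator ?A q \<partial>param_measure) / ?m"
      using nn_integral_uniform_measure[OF measurable_compose[OF measurable_ray[OF p] wE] A']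
      by (simp only: U_def mA)
    also have "\<dots> \<le> (\<integral>\<^sup>+q. ?c * ?m * indicator ?C q \<partial>param_measure) / ?m"
    proof (intro divide_right_mono_ennreal nn_integral_mono)
      fix q assume "q \<in> space param_measure"
      then have q: "q \<in> params" by simp
      have "0 \<le> box_dist p (param q)" by (simp add: box_dist_def)
      then have "ennreal (mcp_coeff t (geo_length strip_metric (ray p q))) \<le> ?c"
        using box_dist_le_half[OF p param_in_strip[OF q]] t
        by (intro ennreal_leI mcp_coeff_le) (auto simp: geo_length_ray[OF p])
      then have "?w (ray p q) \<le> ?c * ?m" by (rule mult_right_mono) simp
      then show "?w (ray p q) * indicator ?E (ray p q) * indicator ?A q \<le> ?c * ?m * indicator ?C q"
        using q by (auto split: split_indicator)
    qed
    also have "\<dots> = ?m * (?c * emeasure param_measure ?C) / ?m"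
      using C by (subst nn_integral_cmult_indicator) (auto simp: mult_ac)
    also have "\<dots> = ?c * emeasure param_measure ?C"
      using m by (simp add: ennreal_mult_divide_eq mult.commute[of ?m])
    also have "\<dots> \<le> emeasure strip_measure B"
      using contraction_along_rays[OF p _ _ B] t by simp
    finally show ?thesis .
  qed
  have "prob_space P" unfolding P_def by (rule U.prob_space_distr[OF ray])
  then show "\<exists>P. prob_space P \<and> sets P = sets (borel_sigma (Geo_topology strip_metric)) \<and>
        distr P strip_measure (\<lambda>\<gamma>. \<gamma> 0) = return strip_measure p \<and>
        distr P strip_measure (\<lambda>\<gamma>. \<gamma> 1) = uniform_measure strip_measure A \<and>
        (\<forall>t\<in>{0..1}. \<forall>B\<in>sets strip_measure.
          emeasure
            (distr
              (density P (\<lambda>\<gamma>. ennreal (mcp_coeff t (geo_length strip_metric \<gamma>)) * emeasure strip_measure A))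
              strip_measure (\<lambda>\<gamma>. \<gamma> t)) B
          \<le> emeasure strip_measure B)"
    using setsP start finish bound by blast
qed

section \<open>Reflections of an initial part of the strip\<close>

definition flip :: "real \<Rightarrow> real \<times> real \<Rightarrow> real \<times> real"
  where "flip z = (\<lambda>p\<in>strip. if fst p < z then (fst p, - snd p) else p)"

lemma flip_in_strip: "p \<in> strip \<Longrightarrow> flip z p \<in> strip"
  by (simp add: flip_def strip_def)

lemma flip_flip: "p \<in> strip \<Longrightarrow> flip z (flip z p) = p"
  by (simp add: flip_def strip_def)

text \<open>The heights of the two points are bounded by a twelfth of their distances to the cut.\<close>

lemma box_dist_across_cut:
  assumes "p \<in> strip" "q \<in> strip" "z \<in> cuts" "fst p \<le> z" "z \<le> fst q"
  shows "box_dist p q = \<bar>fst p - fst q\<bar>"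
proof -
  have "\<bar>snd p - snd q\<bar> \<le> width (fst p) + width (fst q)"
    using assms(1,2) by (intro order_trans[OF abs_triangle_ineq4] add_mono) (auto simp: strip_def)
  also have "\<dots> \<le> \<bar>fst p - z\<bar> / 12 + \<bar>fst q - z\<bar> / 12"
    by (intro add_mono width_le_cut assms)
  also have "\<dots> = \<bar>fst p - fst q\<bar> / 12" using assms(4,5) by (simp add: field_simps)
  also have "\<dots> \<le> \<bar>fst p - fst q\<bar>" by simp
  finally show ?thesis by (simp add: box_dist_def)
qed

lemma box_dist_flip:
  assumes z: "z \<in> cuts" and p: "p \<in> strip" and q: "q \<in> strip"
  shows "box_dist (flip z p) (flip z q) = box_dist p q"
proof -
  have cross: "box_dist (flip z p) (flip z q) = box_dist p q"
    if "p \<in> strip" "q \<in> strip" "fst p < z" "z \<le> fst q" for p q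
    using box_dist_across_cut[OF that(1,2) z] 
      box_dist_across_cut[OF flip_in_strip[OF that(1), of z] flip_in_strip[OF that(2), of z] z]
      that by (simp add: flip_def)
  have commute: "box_dist a b = box_dist b a" for a b
    by (simp add: box_dist_def abs_minus_commute)
  consider "fst p < z" "z \<le> fst q" | "fst q < z" "z \<le> fst p"
    | "fst p < z \<longleftrightarrow> fst q < z" by linarith
  then show ?thesis
  proof cases
    case 3
    then show ?thesis using p q by (auto simp: flip_def box_dist_def)
  qed (use cross p q commute in metis)+
qed

lemma flip_isometry:
  assumes "z \<in> cuts"
  shows "flip z \<in> isometries strip_metric"
proof -
  have "bij_betw (flip z) strip strip"
    by (rule bij_betw_byWitness[where f' = "flip z"]) (auto simp: flip_flip flip_in_strip)
  moreover have "flip z \<in> extensional strip" by (simp add: flip_def)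
  ultimately show ?thesis
    using box_dist_flip[OF assms] by (simp add: isometries_def Bij_def)
qed

text \<open>In the parameters the reflection changes the sign of \<open>s\<close> to the left of \<open>z\<close>. Being a shear with
  slopes of modulus 1 it does not increase Lebesgue measure, and equality follows because it
  is an involution.\<close>

lemma flip_measure_preserving:
  assumes z: "z \<in> cuts"
  shows "distr strip_measure strip_measure (flip z) = strip_measure"
proof (rule measure_eqI)
  fix B assume "B \<in> sets (distr strip_measure strip_measure (flip z))"
  then have B: "B \<in> sets strip_measure" by simp
  define \<rho> :: "real \<times> real \<Rightarrow> real \<times> real"
    where "\<rho> q = (fst q, (if fst q < z then -1 else 1) * snd q)" for q
  have \<rho>_params: "\<rho> q \<in> params \<longleftrightarrow> q \<in> params" for q
    by (cases q) (auto simp: \<rho>_def params_def)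
  have \<rho>_\<rho>: "\<rho> (\<rho> q) = q" for q by (simp add: \<rho>_def)
  have param_\<rho>: "param (\<rho> q) = flip z (param q)" if "q \<in> params" for q
    using param_in_strip[OF that] by (simp add: \<rho>_def param_def flip_def)
  have [measurable]: "fst \<in> borel_measurable (borel :: (real \<times> real) measure)"
    "snd \<in> borel_measurable (borel :: (real \<times> real) measure)"
    by (intro borel_measurable_continuous_onI continuous_intros)+
  have [measurable]: "\<rho> \<in> borel_measurable borel"
    unfolding \<rho>_def by (intro borel_measurable_Pair) measurable
  have pos: "emeasure lborel (\<rho> -` C) \<le> emeasure lborel C" if C [measurable]: "C \<in> sets borel" for C
  proof -
    have "emeasure lborel (\<rho> -` C) = (\<integral>\<^sup>+q. indicator (\<rho> -` C) q \<partial>lborel)"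
      using measurable_sets[OF \<open>\<rho> \<in> borel_measurable borel\<close> C] by simp
    also have "\<dots> = ennreal (1 * 1) * (\<integral>\<^sup>+q. indicator UNIV (fst q) *
        indicator C (0 + 1 * fst q, 0 + (if fst q < z then -1 else 1) * snd q) \<partial>lborel)"
      by (simp add: \<rho>_def indicator_vimage)
    also have "\<dots> \<le> emeasure lborel C"
      by (rule sheared_contraction_integral) auto
    finally show ?thesis .
  qed
  let ?C = "param -` B \<inter> params"
  have C: "?C \<in> sets borel"
    using measurable_sets[OF measurable_param_strip B] by (simp add: sets_param_measure)
  have \<rho>C: "\<rho> -` ?C \<in> sets borel"
    using measurable_sets[OF \<open>\<rho> \<in> borel_measurable borel\<close> C] by simp
  have "\<rho> -` (\<rho> -` S) = S" for S by (simp add: vimage_def \<rho>_\<rho>)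
  then have same: "emeasure lborel (\<rho> -` ?C) = emeasure lborel ?C"
    using pos[OF C] pos[OF \<rho>C] by simp
  have flip: "flip z \<in> measurable strip_measure strip_measure"
    using measurable_borel_sigma[OF isometries_continuous[OF flip_isometry[OF z]]]
      measurable_cong_sets[OF sets_strip_measure_borel_sigma sets_strip_measure_borel_sigma] by blast
  have "emeasure (distr strip_measure strip_measure (flip z)) B
      = emeasure strip_measure (flip z -` B \<inter> strip)"
    using flip B by (simp add: emeasure_distr)
  also have "\<dots> = emeasure param_measure (param -` (flip z -` B \<inter> strip) \<inter> params)"
    using measurable_sets[OF flip B] by (simp add: emeasure_strip_measure)
  also have "param -` (flip z -` B \<inter> strip) \<inter> params = \<rho> -` ?C"
  proof (rule Set.set_eqI)
    fix q
    show "q \<in> param -` (flip z -` B \<inter> strip) \<inter> params \<longleftrightarrow> q \<in> \<rho> -` ?C"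
      by (cases "q \<in> params") (simp_all add: param_\<rho> \<rho>_params param_in_strip)
  qed
  also have "emeasure param_measure \<dots> = emeasure lborel ?C"
    unfolding same[symmetric] using \<rho>_params by (intro emeasure_param_measure) blast
  also have "\<dots> = emeasure strip_measure B"
    by (simp add: emeasure_strip_measure[OF B] emeasure_param_measure)
  finally show "emeasure (distr strip_measure strip_measure (flip z)) B = emeasure strip_measure B" .
qed simp

text \<open>For \<open>m > 0\<close> this is the width at the midpoint of a gap; as the width is positive there, the reflection in
  every cut to the right of it is not the identity.\<close>

lemma width_between_cuts_pos: "0 < width (3/4 * (1/2) ^ m)"
proof -
  let ?h = "(1/2 :: real) ^ m"
  have h: "0 < ?h" by simp
  have "?h / 4 \<le> \<bar>3/4 * ?h - c\<bar>" if "c \<in> cuts" for c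
  proof (cases "c = 0")
    case False
    then obtain k where c: "c = (1/2) ^ k" using \<open>c \<in> cuts\<close> unfolding cuts_def by blast
    show ?thesis
    proof (cases "k \<le> m")
      case True
      then have "?h \<le> c" unfolding c by (intro power_decreasing) auto
      then show ?thesis using h by (auto simp: abs_if)
    next
      case False
      then have "c \<le> (1/2) ^ Suc m" unfolding c by (intro power_decreasing) auto
      then show ?thesis using h by (auto simp: abs_if)
    qed
  qed simp
  then have "?h / 4 \<le> infdist (3/4 * ?h) cuts"
    unfolding infdist_notempty[OF cuts_nonempty]
    by (intro cINF_greatest cuts_nonempty) (simp add: dist_real_def)
  then show ?thesis using h unfolding width_def by linarith
qed

lemma flip_nontrivial: "\<exists>p\<in>strip. flip ((1/2) ^ Suc n) p \<noteq> p"
proof -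
  let ?x = "3/4 * (1/2 :: real) ^ Suc n"
  have "(1/2 :: real) ^ n \<le> 1" by (rule power_le_one) auto
  then have "(?x, width ?x) \<in> strip"
    using width_nonneg[of ?x] by (simp add: strip_def)
  moreover from this have "flip ((1/2) ^ Suc n) (?x, width ?x) \<noteq> (?x, width ?x)"
    using width_between_cuts_pos[of "Suc n"] by (simp add: flip_def)
  ultimately show ?thesis by blast
qed

section \<open>Rigidity of isometries\<close>

lemma strip_0: "(0, 0) \<in> strip" and strip_half: "(1/2, 0) \<in> strip"
  using width_nonneg by (simp_all add: strip_def)

lemma box_dist_ends:
  assumes "p \<in> strip"
  shows "box_dist (0, 0) p = fst p" "box_dist (1/2, 0) p = 1/2 - fst p"
proof -
  show "box_dist (0, 0) p = fst p"
    using box_dist_across_cut[OF strip_0 assms cut_0] assms by (simp add: strip_def)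
  have "box_dist p (1/2, 0) = 1/2 - fst p"
    using box_dist_across_cut[OF assms strip_half cut_half] assms by (simp add: strip_def)
  then show "box_dist (1/2, 0) p = 1/2 - fst p"
    by (simp add: box_dist_def abs_minus_commute)
qed

lemma strip_end:
  assumes "p \<in> strip" "fst p \<in> cuts"
  shows "snd p = 0"
  using assms width_cut[of "fst p"] by (simp add: strip_def)

lemma isometry_in_strip: "g \<in> isometries strip_metric \<Longrightarrow> p \<in> strip \<Longrightarrow> g p \<in> strip"
  using Bij_imp_funcset by (fastforce simp: isometries_def)

text \<open>The height of the strip is at most 1/24, so distance 1/2 is attained by the two end points only. They
  are fixed or exchanged, and first coordinates are distances from an end point.\<close>

lemma isometry_fst:
  assumes g: "g \<in> isometries strip_metric" and p: "p \<in> strip"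
  shows "fst (g p) \<in> {fst p, 1/2 - fst p}"
proof -
  have dist: "box_dist (g a) (g b) = box_dist a b" if "a \<in> strip" "b \<in> strip" for a b
    using g that by (simp add: isometries_def)
  have mem: "g a \<in> strip" if "a \<in> strip" for a using isometry_in_strip[OF g that] .
  let ?a = "g (0, 0)" and ?b = "g (1/2, 0)"
  have a: "?a \<in> strip" and b: "?b \<in> strip" using mem strip_0 strip_half by auto
  have "\<bar>snd ?a - snd ?b\<bar> \<le> 1/24 + 1/24"
  proof (rule order_trans[OF abs_triangle_ineq4 add_mono])
    show "\<bar>snd ?a\<bar> \<le> 1/24" using a width_le(1)[of "fst ?a"] by (auto simp: strip_def)
    show "\<bar>snd ?b\<bar> \<le> 1/24" using b width_le(1)[of "fst ?b"] by (auto simp: strip_def)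
  qed
  moreover have "box_dist ?a ?b = 1/2"
    using dist[OF strip_0 strip_half] by (simp add: box_dist_def)
  ultimately have "\<bar>fst ?a - fst ?b\<bar> = 1/2"
    by (simp add: box_dist_def max_def split: if_splits)
  then have "fst ?a = 0 \<or> fst ?a = 1/2"
    using a b by (auto simp: strip_def abs_if split: if_splits)
  then have "?a = (0, 0) \<or> ?a = (1/2, 0)"
    using strip_end[OF a] cut_0 cut_half by (metis prod.collapse)
  moreover have "fst p = box_dist ?a (g p)"
    using dist[OF strip_0 p] box_dist_ends[OF p] by simp
  ultimately show ?thesis using box_dist_ends[OF mem[OF p]] by auto
qed

text \<open>A fibre is an interval symmetric about 0. If an isometry maps it into itself then it fixes or exchanges the
  two end points, and the distances from these determine the height.\<close>

lemma isometry_snd: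
  assumes g: "g \<in> isometries strip_metric" and p: "p \<in> strip"
    and fst: "\<And>q. q \<in> strip \<Longrightarrow> fst (g q) = fst q"
  shows "snd (g p) \<in> {snd p, - snd p}"
proof -
  let ?w = "width (fst p)"
  define u v where "u = (fst p, ?w)" and "v = (fst p, - ?w)"
  have uv: "u \<in> strip" "v \<in> strip"
    using p width_nonneg by (auto simp: u_def v_def strip_def)
  have dist: "\<bar>snd (g a) - snd (g b)\<bar> = \<bar>snd a - snd b\<bar>"
    if "a \<in> strip" "b \<in> strip" "fst a = fst b" for a b
  proof -
    have "box_dist (g a) (g b) = box_dist a b" using g that by (simp add: isometries_def)
    then show ?thesis using fst[OF that(1)] fst[OF that(2)] that(3) by (simp add: box_dist_def)
  qed
  have "\<bar>snd (g q)\<bar> \<le> ?w" if "q \<in> strip" "fst q = fst p" for q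
    using isometry_in_strip[OF g that(1)] fst[OF that(1)] that(2) by (simp add: strip_def)
  then have "\<bar>snd (g u)\<bar> \<le> ?w" "\<bar>snd (g v)\<bar> \<le> ?w"
    using uv by (auto simp: u_def v_def)
  moreover have "\<bar>snd (g u) - snd (g v)\<bar> = \<bar>2 * ?w\<bar>"
    using dist[OF uv] by (simp add: u_def v_def)
  moreover have "\<bar>snd (g p) - snd (g u)\<bar> = \<bar>snd p - ?w\<bar>" "\<bar>snd (g p) - snd (g v)\<bar> = \<bar>snd p + ?w\<bar>"
    using dist[OF p uv(1)] dist[OF p uv(2)] by (simp_all add: u_def v_def)
  moreover have "\<bar>snd p\<bar> \<le> ?w" using p by (simp add: strip_def)
  ultimately show ?thesis by (smt (verit) insertCI)
qed

section \<open>The isometry groups\<close>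

lemma continuous_map_point_evaluation:
  assumes x: "x \<in> topspace S"
  shows "continuous_map (subtopology (compact_open_topology S T) H) T (\<lambda>f. f x)"
proof (rule continuous_map_from_subtopology)
  show "continuous_map (compact_open_topology S T) T (\<lambda>f. f x)"
    unfolding continuous_map_def[of "compact_open_topology S T"] topspace_compact_open_topology
  proof (intro conjI allI impI)
    show "(\<lambda>f. f x) \<in> {f \<in> extensional (topspace S). continuous_map S T f} \<rightarrow> topspace T"
      using x by (auto dest: continuous_map_funspace)
    fix U assume U: "openin T U"
    have "{f \<in> extensional (topspace S). continuous_map S T f \<and> f ` {x} \<subseteq> U}
        \<in> {{f \<in> extensional (topspace S). continuous_map S T f \<and> f ` K \<subseteq> U} | K U.
          compactin S K \<and> openin T U}"
      using x U by (intro CollectI exI[of _ "{x}"] exI[of _ U]) simp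
    then have "openin (compact_open_topology S T)
        {f \<in> extensional (topspace S). continuous_map S T f \<and> f ` {x} \<subseteq> U}"
      unfolding compact_open_topology_def by (rule topology_generated_by_Basis)
    moreover have "{f \<in> {f \<in> extensional (topspace S). continuous_map S T f}. f x \<in> U}
        = {f \<in> extensional (topspace S). continuous_map S T f \<and> f ` {x} \<subseteq> U}" by auto
    ultimately show "openin (compact_open_topology S T)
        {f \<in> {f \<in> extensional (topspace S). continuous_map S T f}. f x \<in> U}" by simp
  qed
qed

text \<open>For a subbasic open set given by \<open>K\<close> and \<open>U\<close> there are two cases. If \<open>K\<close> contains the left end
  of the strip, then a neighbourhood of this end lies in \<open>U\<close> and a small reflection moves only
  points of that neighbourhood. Otherwise a small reflection moves no point of \<open>K\<close>.\<close>

lemma flips_converge: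
  assumes W: "openin (compact_open_topology (top_of_set strip) (top_of_set strip)) W"
    and "restrict (\<lambda>p. p) strip \<in> W"
  shows "\<forall>\<^sub>F n in sequentially. flip ((1/2) ^ Suc n) \<in> W"
proof -
  let ?S = "{{f \<in> extensional (topspace (top_of_set strip)).
      continuous_map (top_of_set strip) (top_of_set strip) f \<and> f ` K \<subseteq> U} | K U.
      compactin (top_of_set strip) K \<and> openin (top_of_set strip) U}"
  have "generate_topology_on ?S W"
    using W unfolding compact_open_topology_def openin_topology_generated_by_iff .
  then show ?thesis using assms(2)
  proof induction
    case Empty
    then show ?case by simp
  next
    case (Int A B)
    then show ?case by (auto intro: eventually_conj)
  next
    case (UN \<U>)
    then obtain A where "A \<in> \<U>" "restrict (\<lambda>p. p) strip \<in> A" by blast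
    then have "\<forall>\<^sub>F n in sequentially. flip ((1/2) ^ Suc n) \<in> A" by (rule UN.IH)
    then show ?case by eventually_elim (use \<open>A \<in> \<U>\<close> in blast)
  next
    case (Basis V)
    then obtain K U where V: "V = {f \<in> extensional strip.
        continuous_map (top_of_set strip) (top_of_set strip) f \<and> f ` K \<subseteq> U}"
      and K: "compact K" "K \<subseteq> strip" and U: "openin (top_of_set strip) U"
      by (auto simp: compactin_subtopology)
    have KU: "K \<subseteq> U" using Basis.prems K(2) by (auto simp: V)
    obtain e where e: "e > 0" "\<And>z q. z < e \<Longrightarrow> q \<in> K \<Longrightarrow> flip z q \<in> U"
    proof (cases "(0, 0) \<in> K")
      case True
      then obtain r where r: "r > 0" "\<And>q. q \<in> strip \<Longrightarrow> dist q (0, 0) < r \<Longrightarrow> q \<in> U"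
        using U KU unfolding openin_euclidean_subtopology_iff by blast
      have "flip z q \<in> U" if "z < r / 2" "q \<in> K" for z q
      proof (cases "fst q < z")
        case True
        have q: "q \<in> strip" using that(2) K(2) by blast
        then have "fst (flip z q) < z" using True by (simp add: flip_def)
        then have "dist (flip z q) (0, 0) < r"
          using dist_le_box_dist[of "(0, 0)" "flip z q"] box_dist_ends(1)[OF flip_in_strip[OF q], of z]
            that(1) by (simp add: dist_commute)
        then show ?thesis using r(2) flip_in_strip[OF q] by blast
      next
        case False
        then show ?thesis using that(2) K(2) KU by (auto simp: flip_def)
      qed
      then show ?thesis using that[of "r / 2"] r(1) by simp
    next
      case False
      have "open (- K)" using K(1) compact_imp_closed by blast
      then obtain r where r: "r > 0" "ball (0, 0) r \<subseteq> - K"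
        using False openE[of "- K" "(0, 0)"] by blast
      have "flip z q \<in> U" if "z < r / 2" "q \<in> K" for z q
      proof -
        have q: "q \<in> strip" using that(2) K(2) by blast
        have "q \<notin> ball (0, 0) r" using r(2) that(2) by blast
        then have "r \<le> dist (0, 0) q" by simp
        then have "\<not> fst q < z"
          using dist_le_box_dist[of "(0, 0)" q] box_dist_ends(1)[OF q] that(1) by simp
        then show ?thesis using q that(2) KU by (auto simp: flip_def)
      qed
      then show ?thesis using that[of "r / 2"] r(1) by simp
    qed
    have "(\<lambda>n. (1/2 :: real) ^ Suc n) \<longlonglongrightarrow> 0"
      by (intro LIMSEQ_Suc LIMSEQ_power_zero) simp
    then have "\<forall>\<^sub>F n in sequentially. (1/2 :: real) ^ Suc n < e"
      using e(1) by (rule order_tendstoD)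
    then show ?case
    proof eventually_elim
      case (elim n)
      have "(1/2) ^ Suc n \<in> cuts" by (auto simp: cuts_def)
      then have "flip ((1/2) ^ Suc n) \<in> isometries strip_metric" by (rule flip_isometry)
      then have "continuous_map (top_of_set strip) (top_of_set strip) (flip ((1/2) ^ Suc n))"
        using isometries_continuous by (force simp: mtopology_strip_metric)
      moreover have "flip ((1/2) ^ Suc n) \<in> extensional strip"
        unfolding flip_def by (rule restrict_extensional)
      ultimately show ?case using e(2)[OF elim] unfolding V by blast
    qed
  qed
qed

lemma connected_finite_real_values:
  assumes C: "connectedin T C" and f: "continuous_map T euclideanreal f"
    and F: "finite F" "f ` C \<subseteq> F" and "g \<in> C" "h \<in> C"
  shows "f g = f h"
proof -
  have "connected (f ` C)"
    using connectedin_continuous_map_image[OF f C] by simp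
  moreover have "finite (f ` C)" using F finite_subset by blast
  ultimately show ?thesis
    using assms(5,6) connected_finite_iff_sing[of "f ` C"] by (metis empty_iff imageI singletonD)
qed

text \<open>Evaluation at a point is continuous and, by rigidity, each coordinate of it takes finitely many
  values on a connected set of isometries, hence one value. The second coordinate is treated after the
  first, because its rigidity requires that first coordinates are fixed.\<close>

lemma isometries_totally_disconnected:
  assumes H: "H \<subseteq> isometries strip_metric"
    and C: "connectedin (subtopology (compact_open_topology (top_of_set strip) (top_of_set strip)) H) C"
    and C_id: "restrict (\<lambda>p. p) strip \<in> C" and g: "g \<in> C"
  shows "g = restrict (\<lambda>p. p) strip"
proof -
  let ?T = "subtopology (compact_open_topology (top_of_set strip) (top_of_set strip)) H"
  let ?id = "restrict (\<lambda>p. p) strip"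
  have C_iso: "C \<subseteq> isometries strip_metric"
    using H connectedin_subset_topspace[OF C] by auto
  have eval: "continuous_map ?T euclidean (\<lambda>f. f p)" if "p \<in> strip" for p
    using continuous_map_point_evaluation[of p "top_of_set strip" "top_of_set strip" H] that
    by (simp add: continuous_map_in_subtopology)
  have fst: "fst (h p) = fst p" if "h \<in> C" "p \<in> strip" for h p
  proof -
    have "continuous_map ?T euclideanreal (\<lambda>f. fst (f p))"
      using continuous_map_compose[OF eval[OF that(2)], of euclidean fst]
      by (simp add: comp_def continuous_on_fst)
    moreover have "(\<lambda>f. fst (f p)) ` C \<subseteq> {fst p, 1/2 - fst p}"
      using isometry_fst[OF _ that(2)] C_iso by blast
    ultimately have "fst (h p) = fst (?id p)"
      using that(1) C_id
      by (intro connected_finite_real_values[OF C, 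
          where f = "\<lambda>f. fst (f p)" and F = "{fst p, 1/2 - fst p}"]) (assumption | simp only: finite.emptyI finite.insertI)+
    then show ?thesis using that(2) by simp
  qed
  have snd: "snd (g p) = snd p" if "p \<in> strip" for p
  proof -
    have "continuous_map ?T euclideanreal (\<lambda>f. snd (f p))"
      using continuous_map_compose[OF eval[OF that], of euclidean snd]
      by (simp add: comp_def continuous_on_snd)
    moreover have "(\<lambda>f. snd (f p)) ` C \<subseteq> {snd p, - snd p}"
    proof (rule image_subsetI)
      fix k assume k: "k \<in> C"
      then have "k \<in> isometries strip_metric" using C_iso by blast
      then show "snd (k p) \<in> {snd p, - snd p}" using that fst[OF k] by (rule isometry_snd)
    qed
    ultimately have "snd (g p) = snd (?id p)"
      using g C_id
      by (intro connected_finite_real_values[OF C, where f = "\<lambda>f. snd (f p)" and F = "{snd p, - snd p}"]) (assumption | simp only: finite.emptyI finite.insertI)+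
    then show ?thesis using that by simp
  qed
  show ?thesis
  proof (rule extensionalityI[of _ strip])
    show "g \<in> extensional strip" using C_iso g by (auto simp: isometries_def Bij_def)
  qed (use fst[OF g] snd in \<open>auto simp: prod_eq_iff\<close>)
qed

text \<open>The first condition on a Lie group makes the cosets of the identity component open. Here this
  component is trivial, so the identity would be isolated, although reflections converge to it. The
  lemma covers all isometries as well as the measure preserving ones.\<close>

lemma not_lie_group_if_flips:
  assumes H: "H \<subseteq> isometries strip_metric"
    and id: "restrict (\<lambda>p. p) strip \<in> H" and flips: "\<And>z. z \<in> cuts \<Longrightarrow> flip z \<in> H"
  shows "\<not> lie_group ((BijGroup strip)\<lparr>carrier := H\<rparr>)
    (subtopology (compact_open_topology (top_of_set strip) (top_of_set strip)) H)"
    (is "\<not> lie_group ?G ?T")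
proof
  let ?id = "restrict (\<lambda>p. p) strip"
  assume "lie_group ?G ?T"
  moreover define G0 where "G0 = identity_component ?G ?T"
  ultimately have quotient: "quotient_map ?T (discrete_topology (rcosets\<^bsub>?G\<^esub> G0)) (\<lambda>g. G0 #>\<^bsub>?G\<^esub> g)"
    by (simp add: lie_group_def Let_def)
  have one: "\<one>\<^bsub>?G\<^esub> = ?id" by (simp add: BijGroup_def)
  have H_maps: "H \<subseteq> topspace (compact_open_topology (top_of_set strip) (top_of_set strip))"
  proof
    fix h assume "h \<in> H"
    then have "h \<in> isometries strip_metric" using H by blast
    from isometries_continuous[OF this] this
    show "h \<in> topspace (compact_open_topology (top_of_set strip) (top_of_set strip))"
      unfolding topspace_compact_open_topology mtopology_strip_metric
      by (simp add: isometries_def Bij_def)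
  qed
  then have topspace: "topspace ?T = H" by auto
  have "?id \<in> G0"
    using id topspace connected_component_of_refl[of ?T ?id]
    unfolding G0_def identity_component_def one by (simp only: mem_Collect_eq)
  moreover have "connectedin ?T G0"
    unfolding G0_def identity_component_def by (rule connectedin_connected_component_of)
  ultimately have G0: "G0 = {?id}"
    using isometries_totally_disconnected[OF H] by blast
  have coset: "G0 #>\<^bsub>?G\<^esub> g = {g}" if "g \<in> H" for g
  proof -
    have "g \<in> Bij strip" using that H by (auto simp: isometries_def)
    then show ?thesis
      using Bij_imp_funcset[of g strip] Bij_imp_extensional[of g strip]
      by (simp add: r_coset_def G0 BijGroup_def id_Bij)
  qed
  have "openin ?T {g \<in> topspace ?T. G0 #>\<^bsub>?G\<^esub> g \<in> {{?id}}}"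
  proof (rule openin_continuous_map_preimage[OF quotient_imp_continuous_map[OF quotient]])
    show "openin (discrete_topology (rcosets\<^bsub>?G\<^esub> G0)) {{?id}}"
      using id coset[OF id] by (auto simp: RCOSETS_def)
  qed
  also have "{g \<in> topspace ?T. G0 #>\<^bsub>?G\<^esub> g \<in> {{?id}}} = {?id}"
    using id coset unfolding topspace by auto
  finally obtain W where W: "openin (compact_open_topology (top_of_set strip) (top_of_set strip)) W"
    "{?id} = W \<inter> H"
    unfolding openin_subtopology by blast
  have "\<forall>\<^sub>F n in sequentially. flip ((1/2) ^ Suc n) \<in> W"
    using W by (intro flips_converge) auto
  then obtain n where "flip ((1/2) ^ Suc n) \<in> W"
    using eventually_happens sequentially_bot by blast
  moreover have "flip ((1/2) ^ Suc n) \<in> H" by (rule flips) (simp add: cuts_def)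
  ultimately have "flip ((1/2) ^ Suc n) = ?id" using W(2) by blast
  then show False using flip_nontrivial[of n] by auto
qed

theorem proposition1p5:
  shows "\<exists>(X :: (real \<times> real) metric) (\<mu> :: (real \<times> real) measure).
    MCP_2_3 X \<mu> \<and>
    \<not> lie_group (ISO_meas X \<mu>) (ISO_meas_topology X \<mu>) \<and>
    \<not> lie_group (ISO X) (ISO_topology X)"
proof (intro exI conjI)
  have id: "restrict (\<lambda>p. p) strip \<in> isometries strip_metric"
    by (simp add: isometries_def id_Bij)
  have "distr strip_measure strip_measure (restrict (\<lambda>p. p) strip)
      = distr strip_measure strip_measure (\<lambda>p. p)"
    by (rule distr_cong) simp_all
  then have id_meas: "distr strip_measure strip_measure (restrict (\<lambda>p. p) strip) = strip_measure"
    by (simp add: distr_id2)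
  show "MCP_2_3 strip_metric strip_measure" by (rule MCP_strip)
  show "\<not> lie_group (ISO strip_metric) (ISO_topology strip_metric)"
    using not_lie_group_if_flips[OF order_refl id flip_isometry]
    by (simp add: ISO_def ISO_topology_def mtopology_strip_metric)
  show "\<not> lie_group (ISO_meas strip_metric strip_measure) (ISO_meas_topology strip_metric strip_measure)"
    using not_lie_group_if_flips[of "{f \<in> isometries strip_metric. distr strip_measure strip_measure f = strip_measure}"]
      id id_meas flip_isometry flip_measure_preserving
    by (simp add: ISO_meas_def ISO_meas_topology_def mtopology_strip_metric)
qed

end
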